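(* Let $N\ge 2$ and $x\in\mathbb R$, and let $H$ be the integrable spin-one XXZ Hamiltonian on $N$ sites with the anti-diagonal twist. Then the non-zero parts of the spectra of $H$ restricted to the two subspaces $\{(-1)^M=1\}$ and $\{(-1)^M=-1\}$ of $V$ coincide, including degeneracies; i.e. for every $E\neq0$, the eigenspaces of the two restrictions of $H$ for the eigenvalue $E$ have the same dimension.
   Context: $V=(\mathbb C^3)^{\otimes N}$, with single-site basis $|{\Uparrow}\rangle=(1,0,0)^t$, $|0\rangle=(0,1,0)^t$, $|{\Downarrow}\rangle=(0,0,1)^t$. Spin-one matrices: $s^1=\frac1{\sqrt2}\begin{pmatrix}0&1&0\\1&0&1\\0&1&0\end{pmatrix}$, $s^2=\frac1{\sqrt2}\begin{pmatrix}0&-\mathrm i&0\\ \mathrm i&0&-\mathrm i\\0&\mathrm i&0\end{pmatrix}$, $s^3=\mathrm{diag}(1,0,-1)$; $s^a_j$ is $s^a$ acting on site $j$. The Hamiltonian is $$H=\sum_{j=1}^N\Big(\sum_{a=1}^3J_a\big(s_j^as_{j+1}^a+2(s_j^a)^2\big)-\sum_{a,b=1}^3A_{ab}\,s_j^as_j^bs_{j+1}^as_{j+1}^b\Big),$$ with $J_1=J_2=1$, $J_3=\frac12(x^2-2)$, $A_{ab}=A_{ba}$, $A_{aa}=J_a$, $A_{12}=1$, $A_{13}=A_{23}=x-1$. Anti-diagonal twist: $s^1_{N+1}=s^1_1$, $s^2_{N+1}=-s^2_1$, $s^3_{N+1}=-s^3_1$. The magnetisation is $M=\sum_{j=1}^Ns_j^3$;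 with this twist $[H,(-1)^M]=0$. *)

theory Defs
  imports "HOL-Analysis.Analysis" "HOL-Library.Function_Algebras"
begin

text \<open>
  A vector is given by its components in the product basis: the list \<open>w\<close> of length \<open>N\<close>
  stands for the basis vector whose \<open>j\<close>-th tensor factor is the \<open>w ! j\<close>-th single-site basis
  vector, where \<open>1, 2, 3 :: 3\<close> are up, zero, down in this order. The spaces for all \<open>N\<close> live in
  one ambient type, and sites are numbered \<open>0, \<dots>, N - 1\<close>.
\<close>

type_synonym spin_state = "3 list \<Rightarrow> complex"

definition scaleC :: "complex \<Rightarrow> spin_state \<Rightarrow> spin_state" (infixr "*\<^sub>C" 75)
  where "c *\<^sub>C \<psi> = (\<lambda>w. c * \<psi> w)"

interpretation chain: vector_space scaleC
  by unfold_locales (auto simp: scaleC_def fun_eq_iff algebra_simps)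

definition chain_space :: "nat \<Rightarrow> spin_state set"
  where "chain_space N = {\<psi>. \<forall>w. length w \<noteq> N \<longrightarrow> \<psi> w = 0}"

definition spin_matrix :: "3 \<Rightarrow> complex^3^3"
  where "spin_matrix a =
    (if a = 1 then (\<chi> i k. complex_of_real (1 / sqrt 2) *
        (vector [vector [0, 1, 0], vector [1, 0, 1], vector [0, 1, 0]] :: complex^3^3) $ i $ k)
     else if a = 2 then (\<chi> i k. complex_of_real (1 / sqrt 2) *
        (vector [vector [0, -\<i>, 0], vector [\<i>, 0, -\<i>], vector [0, \<i>, 0]] :: complex^3^3) $ i $ k)
     else vector [vector [1, 0, 0], vector [0, 0, 0], vector [0, 0, -1]])"

definition site_op :: "complex^3^3 \<Rightarrow> nat \<Rightarrow> spin_state \<Rightarrow> spin_state"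
  where "site_op A j \<psi> = (\<lambda>w. \<Sum>k\<in>UNIV. A $ (w ! j) $ k * \<psi> (w[j := k]))"

text \<open>The site index \<open>N\<close> denotes the anti-diagonally twisted copy of site \<open>0\<close>.\<close>

definition twisted_spin :: "nat \<Rightarrow> 3 \<Rightarrow> nat \<Rightarrow> spin_state \<Rightarrow> spin_state"
  where "twisted_spin N a j =
    (if j < N then site_op (spin_matrix a) j
     else (\<lambda>\<psi>. (if a = 1 then 1 else -1) *\<^sub>C site_op (spin_matrix a) 0 \<psi>))"

definition coupling_J :: "real \<Rightarrow> real^3"
  where "coupling_J x = vector [1, 1, (x\<^sup>2 - 2) / 2]"

definition coupling_A :: "real \<Rightarrow> real^3^3"
  where "coupling_A x =
    vector [vector [coupling_J x $ 1, 1, x - 1],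
            vector [1, coupling_J x $ 2, x - 1],
            vector [x - 1, x - 1, coupling_J x $ 3]]"

definition hamiltonian :: "nat \<Rightarrow> real \<Rightarrow> spin_state \<Rightarrow> spin_state"
  where "hamiltonian N x \<psi> =
    (let s = twisted_spin N in
     \<Sum>j<N.
       (\<Sum>a\<in>UNIV. complex_of_real (coupling_J x $ a) *\<^sub>C
          (s a j (s a (j + 1) \<psi>) + 2 *\<^sub>C s a j (s a j \<psi>)))
     - (\<Sum>a\<in>UNIV. \<Sum>b\<in>UNIV. complex_of_real (coupling_A x $ a $ b) *\<^sub>C
          s a j (s b j (s a (j + 1) (s b (j + 1) \<psi>)))))"

definition magnetisation :: "nat \<Rightarrow> spin_state \<Rightarrow> spin_state"
  where "magnetisation N \<psi> = (\<Sum>j<N. site_op (spin_matrix 3) j \<psi>)"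

text \<open>
  The operator \<open>M\<close> is diagonal in the product basis, with the integer eigenvalues \<open>config_mag\<close>,
  and \<open>(-1)^M\<close> is the corresponding function of \<open>M\<close>. The two lemmas below link
  these definitions to \<open>M\<close> itself.
\<close>

definition config_mag :: "3 list \<Rightarrow> int"
  where "config_mag w = (\<Sum>k\<leftarrow>w. if k = 1 then 1 else if k = 2 then 0 else -1)"

definition parity_op :: "spin_state \<Rightarrow> spin_state"
  where "parity_op \<psi> = (\<lambda>w. (-1) powi config_mag w * \<psi> w)"

lemma spin_matrix_3:
  "spin_matrix 3 $ i $ k = (if i = k then of_int (if i = 1 then 1 else if i = 2 then 0 else -1) else 0)"
  using exhaust_3[of i] exhaust_3[of k]
  by (auto simp: spin_matrix_def)

lemma magnetisation_diagonal:
  assumes "\<psi> \<in> chain_space N"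
  shows "magnetisation N \<psi> = (\<lambda>w. of_int (config_mag w) * \<psi> w)"
proof
  fix w :: "3 list"
  define m where "m = (\<lambda>k::3. (if k = 1 then 1 else if k = 2 then 0 else -1) :: int)"
  have site: "site_op (spin_matrix 3) j \<psi> w = of_int (m (w ! j)) * \<psi> w" for j
    by (simp add: site_op_def spin_matrix_3 m_def if_distrib[where f = "\<lambda>c. c * _"] sum.delta'
        cong: if_cong)
  have sum_fun: "(\<Sum>j\<in>A. f j) w = (\<Sum>j\<in>A. f j w)" for A and f :: "nat \<Rightarrow> spin_state"
    by (induction A rule: infinite_finite_induct) auto
  have "magnetisation N \<psi> w = (\<Sum>j<N. of_int (m (w ! j))) * \<psi> w"
    by (simp add: magnetisation_def sum_fun site sum_distrib_right)
  also have "\<dots> = of_int (config_mag w) * \<psi> w"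
  proof (cases "length w = N")
    case True
    have "config_mag w = (\<Sum>j<N. m (w ! j))"
      using True by (simp add: config_mag_def m_def sum_list_sum_nth atLeast0LessThan)
    then show ?thesis by simp
  next
    case False
    with assms show ?thesis by (simp add: chain_space_def)
  qed
  finally show "magnetisation N \<psi> w = of_int (config_mag w) * \<psi> w" .
qed

lemma parity_op_eigenvector:
  assumes "\<psi> \<in> chain_space N" "magnetisation N \<psi> = of_int m *\<^sub>C \<psi>"
  shows "parity_op \<psi> = ((-1) powi m) *\<^sub>C \<psi>"
proof
  fix w
  have "of_int (config_mag w) * \<psi> w = of_int m * \<psi> w"
    using assms magnetisation_diagonal[OF assms(1)] by (metis scaleC_def)
  then show "parity_op \<psi> w = (((-1) powi m) *\<^sub>C \<psi>) w"
    by (auto simp: parity_op_def scaleC_def)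
qed

definition parity_sector :: "nat \<Rightarrow> complex \<Rightarrow> spin_state set"
  where "parity_sector N \<sigma> = {\<psi> \<in> chain_space N. parity_op \<psi> = \<sigma> *\<^sub>C \<psi>}"

definition eigenspace_on ::
    "spin_state set \<Rightarrow> (spin_state \<Rightarrow> spin_state) \<Rightarrow> complex \<Rightarrow> spin_state set"
  where "eigenspace_on U T E = {\<psi> \<in> U. T \<psi> = E *\<^sub>C \<psi>}"

end

theory Submission
  imports Defs
begin

text \<open>
  Let \<open>T\<close> be a transfer matrix with spin-\<open>1/2\<close> auxiliary space and anti-diagonal twist. It commutes
  with \<open>H\<close>, but anticommutes with \<open>(-1)\<^sup>M\<close>, since the twist flips the auxiliary spin. By fusion, the product
  of two commuting such operators is the spin-one transfer matrix up to a scalar. Writing \<open>str A\<close> for the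
  trace of \<open>(-1)\<^sup>M A\<close>, we get \<open>str (T T' Y) = 0\<close> for every \<open>Y\<close> commuting with the transfer
  matrices, because odd operators are anticyclic under \<open>str\<close>. At a special value of the spectral
  parameter the fused transfer matrix is a multiple of the twisted translation, and its derivative
  there yields \<open>H\<close>; the scalars cancel and \<open>str (H\<^sup>k) = 0\<close> for all \<open>k \<ge> 1\<close>. This is
  proved for \<open>x \<noteq> 0\<close> and extends to \<open>x = 0\<close> by continuity. As \<open>H\<close> is Hermitian, the projection onto the
  eigenspace of \<open>E \<noteq> 0\<close> is a polynomial in \<open>H\<close> without constant term, so its supertrace, which is the
  difference of the two dimensions, vanishes.
\<close>

section \<open>Kernels on configurations and matrix product operators\<close>

text \<open>Two auxiliary spins 1/2 whose spectral parameters differ by eta split into a triplet and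
  a singlet. The triplet gives the spin-one transfer matrix, the singlet the scalar
  \<open>(t - x * (1 - x * t + t\<^sup>2)) ^ N\<close> (the quantum determinant), so the supertrace
  identity concerns the difference of the two. At t = 0 this scalar and the multiple of the identity
  that differentiation adds to H have the same logarithmic derivative -N (1 + x^2) / x. Therefore
  one combination of derivative and value at t = 0 removes both. The Lax matrices contain a square
  root s, but their products depend only on s^2, which is polynomial in x and t. Thus the function
  that is differentiated is polynomial in t, and no branch of s has to be followed. The eigenvalue 0
  is a genuine exception: each site contributes -1 + 1 - 1 to the supertrace of the identity, which
  is therefore (-1)^N, so the two sectors already differ in dimension. This is why constant terms
  must be kept out of the polynomials in H.\<close>

lemma sum_fun_apply: "(\<Sum>j\<in>A. f j) w = (\<Sum>j\<in>A. f j w)" for f :: "'i \<Rightarrow> 'a \<Rightarrow> 'b::comm_monoid_add"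
  by (induction A rule: infinite_finite_induct) auto

definition configs :: "nat \<Rightarrow> 'a list set"
  where "configs N = {w. length w = N}"

lemma configs_0 [simp]: "configs 0 = {[]}"
  by (auto simp: configs_def)

lemma finite_configs [simp]: "finite (configs N :: 'a::finite list set)"
  using finite_lists_length_eq[of "UNIV :: 'a set" N] by (simp add: configs_def)

lemma sum_configs_Suc:
  fixes f :: "'a::finite list \<Rightarrow> 'b::comm_monoid_add"
  shows "(\<Sum>w\<in>configs (Suc n). f w) = (\<Sum>a\<in>UNIV. \<Sum>w\<in>configs n. f (a # w))"
proof -
  have eq: "configs (Suc n) = (\<lambda>(a, w). a # w) ` (UNIV \<times> configs n)"
    by (auto simp: configs_def image_iff length_Suc_conv)
  have inj: "inj_on (\<lambda>(a, w). a # w) (UNIV \<times> configs n)"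
    by (auto intro!: inj_onI)
  have "(\<Sum>w\<in>configs (Suc n). f w) = (\<Sum>(a, w)\<in>UNIV \<times> configs n. f (a # w))"
    unfolding eq sum.reindex[OF inj] by (simp add: o_def split_def)
  then show ?thesis
    by (simp add: sum.cartesian_product)
qed

type_synonym 'a kernel = "'a list \<Rightarrow> 'a list \<Rightarrow> complex"

text \<open>The cut-off outside \<open>configs N\<close> turns agreement of entries on chains of
  length N into equality of functions, which allows rewriting with products.\<close>

definition kmul :: "nat \<Rightarrow> 'a::finite kernel \<Rightarrow> 'a kernel \<Rightarrow> 'a kernel"
  where "kmul N A B w v =
    (if w \<in> configs N \<and> v \<in> configs N then \<Sum>u\<in>configs N. A w u * B u v else 0)"

lemma kmul_eqI:
  assumes "\<And>w v. w \<in> configs N \<Longrightarrow> v \<in> configs N \<Longrightarrow>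
    (\<Sum>u\<in>configs N. A w u * B u v) = (\<Sum>u\<in>configs N. C w u * D u v)"
  shows "kmul N A B = kmul N C D"
  using assms by (auto simp: kmul_def fun_eq_iff)

lemma kmul_assoc: "kmul N (kmul N A B) C = kmul N A (kmul N B C)"
  unfolding kmul_def fun_eq_iff
  by (auto simp: sum_distrib_left sum_distrib_right mult.assoc intro: sum.swap)

definition mprod :: "('a \<Rightarrow> 'a \<Rightarrow> complex^'n^'n) \<Rightarrow> 'a list \<Rightarrow> 'a list \<Rightarrow> complex^'n^'n"
  where "mprod L w v = foldr (\<lambda>(a, b) A. L a b ** A) (zip w v) (mat 1)"

lemma mprod_simps [simp]:
  "mprod L [] [] = mat 1"
  "mprod L (a # w) (b # v) = L a b ** mprod L w v"
  by (simp_all add: mprod_def)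

lemma mprod_append:
  "length w = length v \<Longrightarrow> mprod L (w @ w') (v @ v') = mprod L w v ** mprod L w' v'"
  by (induction w v rule: list_induct2) (simp_all add: matrix_mul_assoc)

text \<open>\<open>P\<close> may be rectangular, so a quotient or an invariant subspace of the
  auxiliary space passes from one site to the whole chain. Fusion rests on this.\<close>

lemma mprod_intertwine:
  fixes P :: "complex^'n^'m"
  assumes "\<And>a b. P ** K a b = L a b ** P" "length w = length v"
  shows "P ** mprod K w v = mprod L w v ** P"
  using assms(2)
  by (induction w v rule: list_induct2)
    (simp_all add: matrix_mul_assoc assms(1), simp add: matrix_mul_assoc[symmetric])

lemma mprod_conj:
  assumes "\<And>a b. X ** L a b = L (f a) (f b) ** X" "length w = length v"
  shows "X ** mprod L w v = mprod L (map f w) (map f v) ** X"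
  using assms(2)
proof (induction w v rule: list_induct2)
  case (Cons a w b v)
  then show ?case
    by (simp add: matrix_mul_assoc assms(1)) (simp add: matrix_mul_assoc[symmetric])
qed simp

lemma trace_cyclic:
  fixes A :: "complex^'n^'m" and B :: "complex^'m^'n"
  shows "trace (A ** B) = trace (B ** A)"
  unfolding trace_def matrix_matrix_mult_def
  by (simp add: mult.commute) (rule sum.swap)

lemma matrix_diff_mult:
  fixes A B :: "complex^'n^'m"
  shows "(A - B) ** C = A ** C - B ** C"
  by (simp add: matrix_matrix_mult_def vec_eq_iff left_diff_distrib sum_subtractf)

lemma matrix_mult_diff:
  fixes A B :: "complex^'n^'m"
  shows "C ** (A - B) = C ** A - C ** B"
  by (simp add: matrix_matrix_mult_def vec_eq_iff right_diff_distrib sum_subtractf)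

definition kron :: "complex^'n^'m \<Rightarrow> complex^'q^'p \<Rightarrow> complex^('n \<times> 'q)^('m \<times> 'p)"
  where "kron A B = (\<chi> i j. A $ fst i $ fst j * B $ snd i $ snd j)"

lemma kron_mult: "kron A B ** kron C D = kron (A ** C) (B ** D)"
  by (simp add: kron_def matrix_matrix_mult_def vec_eq_iff sum_product UNIV_Times_UNIV[symmetric]
      sum.cartesian_product split_def mult_ac del: UNIV_Times_UNIV)

lemma kron_one [simp]: "kron (mat 1) (mat 1) = mat 1"
  by (auto simp: kron_def mat_def vec_eq_iff)

lemma trace_kron: "trace (kron A B) = trace A * trace B"
  by (simp add: kron_def trace_def sum_product UNIV_Times_UNIV[symmetric]
      sum.cartesian_product split_def del: UNIV_Times_UNIV)

lemma matrix_mult_sum: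
  fixes f :: "'i \<Rightarrow> complex^'n^'m"
  shows "(\<Sum>i\<in>I. f i) ** B = (\<Sum>i\<in>I. f i ** B)" "C ** (\<Sum>i\<in>I. f i) = (\<Sum>i\<in>I. C ** f i)"
  by (simp_all add: matrix_matrix_mult_def vec_eq_iff sum_distrib_left sum_distrib_right)
    (simp_all add: sum.swap[of _ _ I])

lemma trace_sum:
  fixes f :: "'i \<Rightarrow> complex^'n^'n"
  shows "trace (\<Sum>i\<in>I. f i) = (\<Sum>i\<in>I. trace (f i))"
  by (simp add: trace_def) (rule sum.swap)

definition mpo :: "complex^'n^'n \<Rightarrow> ('a \<Rightarrow> 'a \<Rightarrow> complex^'n^'n) \<Rightarrow> 'a kernel"
  where "mpo X L w v = trace (X ** mprod L w v)"

definition kron_site :: "('a::finite \<Rightarrow> 'a \<Rightarrow> complex^'n^'n) \<Rightarrow> ('a \<Rightarrow> 'a \<Rightarrow> complex^'m^'m) \<Rightarrow>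
    'a \<Rightarrow> 'a \<Rightarrow> complex^('n \<times> 'm)^('n \<times> 'm)"
  where "kron_site L L' a b = (\<Sum>c\<in>UNIV. kron (L a c) (L' c b))"

text \<open>Summing out the intermediate letter at each site separately is the same as summing over
  intermediate configurations. Hence a product of matrix product operators is again one, on the
  tensor product of the auxiliary spaces.\<close>

lemma mprod_kron_site:
  assumes "length w = length v"
  shows "mprod (kron_site L L') w v = (\<Sum>u\<in>configs (length w). kron (mprod L w u) (mprod L' u v))"
  using assms
proof (induction w v rule: list_induct2)
  case (Cons a w b v)
  then show ?case
    by (simp add: sum_configs_Suc kron_site_def matrix_mult_sum kron_mult[symmetric])
      (rule sum.swap)
qed simp

lemma mpo_product:
  assumes "w \<in> configs N" "v \<in> configs N"
  shows "(\<Sum>u\<in>configs N. mpo X L w u * mpo Y L' u v) = mpo (kron X Y) (kron_site L L') w v"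
  using assms
  by (simp add: mpo_def configs_def mprod_kron_site matrix_mult_sum trace_sum kron_mult trace_kron)

section \<open>Twisted rotation and supertrace\<close>

text \<open>Conjugation by this permutation fixes the first spin matrix and negates the other two
  (\<open>spin_matrix_flip\<close>), so it implements the anti-diagonal twist.\<close>

definition flip :: "3 \<Rightarrow> 3"
  where "flip a = (if a = 1 then 3 else if a = 3 then 1 else 2)"

lemma flip_simps [simp]: "flip 1 = 3" "flip 2 = 2" "flip 3 = 1" "flip (flip a) = a"
  using exhaust_3[of a] by (auto simp: flip_def)

lemma flip_eq_iff [simp]: "flip a = flip b \<longleftrightarrow> a = b"
  by (metis flip_simps(4))

lemma map_flip_flip [simp]: "map (flip \<circ> flip) w = w" "map flip (map flip w) = w"
  by (simp_all add: comp_def)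

text \<open>The letter that crosses the boundary is flipped. Hence N rotations give the global flip,
  not the identity.\<close>

fun rot :: "3 list \<Rightarrow> 3 list"
  where "rot [] = []" | "rot (a # w) = w @ [flip a]"

lemma length_rot [simp]: "length (rot w) = length w"
  by (cases w) auto

lemma rot_in_configs [simp]: "rot w \<in> configs N \<longleftrightarrow> w \<in> configs N"
  by (simp add: configs_def)

lemma rot_funpow_in_configs [simp]: "(rot ^^ k) w \<in> configs N \<longleftrightarrow> w \<in> configs N"
  by (induction k) auto

lemma rot_inject [simp]: "rot w = rot v \<longleftrightarrow> w = v"
  by (cases w; cases v) auto

lemma rot_funpow_inject [simp]: "(rot ^^ k) w = (rot ^^ k) v \<longleftrightarrow> w = v"
  by (induction k) auto

lemma rot_funpow_append: "length p = k \<Longrightarrow> (rot ^^ k) (p @ q) = q @ map flip p"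
proof (induction k arbitrary: p q)
  case (Suc k)
  then obtain a p' where "p = a # p'" "length p' = k"
    by (auto simp: length_Suc_conv)
  then show ?case
    using Suc.IH[of p' "q @ [flip a]"] by (simp add: funpow_Suc_right del: funpow.simps)
qed simp

lemma rot_funpow_length: "w \<in> configs N \<Longrightarrow> (rot ^^ N) w = map flip w"
  using rot_funpow_append[of w N "[]"] by (simp add: configs_def)

lemma bij_rot: "bij_betw rot (configs N) (configs N)"
proof (rule bij_betwI')
  show "\<exists>x\<in>configs N. y = rot x" if "y \<in> configs N" for y
  proof (cases "y = []")
    case False
    then have "rot (flip (last y) # butlast y) = y"
      by simp
    then show ?thesis
      using that by (metis rot_in_configs)
  qed (use that in \<open>auto simp: configs_def\<close>)
qed auto

lemma bij_rot_funpow: "bij_betw (rot ^^ k) (configs N) (configs N)"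
proof (induction k)
  case (Suc k)
  show ?case
    using bij_betw_trans[OF Suc bij_rot] by (simp add: o_def)
qed (simp add: bij_betw_def)

lemma sum_rot_funpow:
  "(\<Sum>w\<in>configs N. f ((rot ^^ k) w)) = (\<Sum>w\<in>configs N. f w)"
  by (rule sum.reindex_bij_betw[OF bij_rot_funpow])

lemma sum_rot: "(\<Sum>w\<in>configs N. f (rot w)) = (\<Sum>w\<in>configs N. f w)"
  by (rule sum.reindex_bij_betw[OF bij_rot])

definition sgn_mag :: "3 list \<Rightarrow> complex"
  where "sgn_mag w = (-1) powi config_mag w"

lemma config_mag_Cons:
  "config_mag (a # w) = (if a = 1 then 1 else if a = 2 then 0 else -1) + config_mag w"
  by (simp add: config_mag_def)

lemma sgn_mag_Nil [simp]: "sgn_mag [] = 1"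
  by (simp add: sgn_mag_def config_mag_def)

lemma sgn_mag_Cons [simp]: "sgn_mag (a # w) = (if a = 2 then 1 else -1) * sgn_mag w"
  using exhaust_3[of a]
  by (auto simp: sgn_mag_def config_mag_Cons power_int_add power_int_minus)

lemma sgn_mag_append: "sgn_mag (w @ v) = sgn_mag w * sgn_mag v"
  by (induction w) auto

lemma sgn_mag_square [simp]: "sgn_mag w * sgn_mag w = 1"
  by (induction w) auto

lemma flip_eq_2 [simp]: "flip a = 2 \<longleftrightarrow> a = 2"
  using exhaust_3[of a] by auto

lemma sgn_mag_rot [simp]: "sgn_mag (rot w) = sgn_mag w"
  by (cases w) (auto simp: sgn_mag_append)

section \<open>Supertrace and parity-odd kernels\<close>

definition strace :: "nat \<Rightarrow> 3 kernel \<Rightarrow> complex"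
  where "strace N A = (\<Sum>w\<in>configs N. sgn_mag w * A w w)"

lemma strace_kmul: "strace N (kmul N A B) = (\<Sum>w\<in>configs N. \<Sum>u\<in>configs N. sgn_mag w * A w u * B u w)"
  by (simp add: strace_def kmul_def sum_distrib_left mult.assoc)

definition parity_odd :: "3 kernel \<Rightarrow> bool"
  where "parity_odd A \<longleftrightarrow> (\<forall>w v. length w = length v \<longrightarrow> sgn_mag w * A w v = - (A w v * sgn_mag v))"

lemma strace_odd_anticyclic:
  assumes "parity_odd A"
  shows "strace N (kmul N A B) = - strace N (kmul N B A)"
proof -
  have "strace N (kmul N A B) = (\<Sum>w\<in>configs N. \<Sum>u\<in>configs N. - (sgn_mag u * B u w * A w u))"
    unfolding strace_kmul using assms
    by (intro sum.cong refl) (simp add: parity_odd_def configs_def mult_ac)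
  also have "\<dots> = - strace N (kmul N B A)"
    unfolding strace_kmul by (subst sum.swap) (simp add: sum_negf)
  finally show ?thesis .
qed

text \<open>Anticyclicity moves \<open>A\<close> to the far end with a sign, and the commutation
  relations bring it back without one, so the supertrace equals its own negative.\<close>

lemma strace_product_odd:
  assumes "parity_odd A" "kmul N A B = kmul N B A" "kmul N Y A = kmul N A Y"
  shows "strace N (kmul N (kmul N A B) Y) = 0"
proof -
  have "strace N (kmul N (kmul N A B) Y) = - strace N (kmul N (kmul N B Y) A)"
    by (simp add: kmul_assoc strace_odd_anticyclic[OF assms(1)])
  also have "kmul N (kmul N B Y) A = kmul N (kmul N A B) Y"
    by (simp add: kmul_assoc assms)
  finally show ?thesis by simp
qed

definition twist_covariant :: "complex^'n^'n \<Rightarrow> (3 \<Rightarrow> 3 \<Rightarrow> complex^'n^'n) \<Rightarrow> bool"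
  where "twist_covariant X L \<longleftrightarrow> X ** X = mat 1 \<and> (\<forall>a b. X ** L a b = L (flip a) (flip b) ** X)"

text \<open>A matrix product operator with a defect on the first site. It serves both as the
  telescoping term of the commutator with a bond and as a term of the Leibniz rule.\<close>

definition mpo_first :: "complex^'n^'n \<Rightarrow> (3 \<Rightarrow> 3 \<Rightarrow> complex^'n^'n) \<Rightarrow> (3 \<Rightarrow> 3 \<Rightarrow> complex^'n^'n) \<Rightarrow> 3 kernel"
  where "mpo_first X L' L w v =
    (case (w, v) of (a # w', b # v') \<Rightarrow> trace (X ** (L' a b ** mprod L w' v')) | _ \<Rightarrow> 0)"

text \<open>Cyclicity of the trace brings the flipped last factor in front of \<open>X\<close>, and
  moving it through \<open>X\<close> removes the flips.\<close>

lemma mpo_rot: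
  assumes "twist_covariant X L" "length w = length v"
  shows "mpo X L (rot w) (rot v) = mpo X L w v"
proof (cases w; cases v)
  fix a w' b v'
  assume wv: "w = a # w'" "v = b # v'"
  then have len: "length w' = length v'" using assms by simp
  have X: "X ** X = mat 1" "L (flip a) (flip b) ** X = X ** L a b"
    using assms by (auto simp: twist_covariant_def)
  have "trace (X ** (mprod L w' v' ** L (flip a) (flip b))) =
      trace (mprod L w' v' ** (L (flip a) (flip b) ** X))"
    by (subst trace_cyclic) (simp add: matrix_mul_assoc)
  also have "\<dots> = trace (X ** (L a b ** mprod L w' v'))"
    unfolding X by (subst trace_cyclic) (simp add: matrix_mul_assoc)
  finally show ?thesis
    using wv len by (simp add: mpo_def mprod_append)
qed (use assms in auto)

lemma mpo_rot_funpow: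
  assumes "twist_covariant X L" "length w = length v"
  shows "mpo X L ((rot ^^ k) w) ((rot ^^ k) v) = mpo X L w v"
proof (induction k)
  case (Suc k)
  have "length ((rot ^^ k) w) = length ((rot ^^ k) v)"
    using assms(2) by (induction k) auto
  then show ?case
    using Suc by (simp add: mpo_rot[OF assms(1)])
qed simp

definition cscale :: "complex \<Rightarrow> complex^'n^'m \<Rightarrow> complex^'n^'m"
  where "cscale c A = (\<chi> i j. c * A $ i $ j)"

lemma cscale_mult [simp]: "cscale c A ** B = cscale c (A ** B)" "A ** cscale c B = cscale c (A ** B)"
  by (simp_all add: cscale_def matrix_matrix_mult_def vec_eq_iff sum_distrib_left mult_ac)

lemma trace_cscale: "trace (cscale c A) = c * trace A"
  by (simp add: cscale_def trace_def sum_distrib_left)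

definition bond :: "(3 \<Rightarrow> 3 \<Rightarrow> 3 \<Rightarrow> 3 \<Rightarrow> complex) \<Rightarrow> 3 kernel"
  where "bond g w v =
    (case (w, v) of (a # b # w', c # d # v') \<Rightarrow> g a b c d * of_bool (w' = v') | _ \<Rightarrow> 0)"

text \<open>
  Summing over powers of the twisted rotation makes the twisted boundary bond the same as all others.
\<close>

definition chain_kernel :: "nat \<Rightarrow> (3 \<Rightarrow> 3 \<Rightarrow> 3 \<Rightarrow> 3 \<Rightarrow> complex) \<Rightarrow> 3 kernel"
  where "chain_kernel N g w v = (\<Sum>k<N. bond g ((rot ^^ k) w) ((rot ^^ k) v))"

text \<open>After N steps the twisted rotation has flipped every letter, so it is invariance of
  \<open>D\<close> under the global flip that makes the two end terms cancel.\<close>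

lemma rot_telescope:
  fixes D :: "3 kernel"
  assumes "w \<in> configs N" "v \<in> configs N" "D (map flip w) (map flip v) = D w v"
  shows "(\<Sum>k<N. D ((rot ^^ k) w) ((rot ^^ k) v) - D (rot ((rot ^^ k) w)) (rot ((rot ^^ k) v))) = 0"
proof -
  have "(\<Sum>k<N. D ((rot ^^ k) w) ((rot ^^ k) v) - D (rot ((rot ^^ k) w)) (rot ((rot ^^ k) v))) =
      D w v - D ((rot ^^ N) w) ((rot ^^ N) v)"
    using sum_lessThan_telescope'[of "\<lambda>k. D ((rot ^^ k) w) ((rot ^^ k) v)" N] by simp
  then show ?thesis
    using assms by (simp add: rot_funpow_length)
qed

lemma configs_ge_2E:
  assumes "w \<in> configs N" "N \<ge> 2"
  obtains a b u where "w = a # b # u" "u \<in> configs (N - 2)"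
  using assms by (cases w; cases "tl w") (auto simp: configs_def)

lemma mpo_first_flip:
  assumes "twist_covariant X L" "\<And>a b. X ** L' a b = L' (flip a) (flip b) ** X" "length w = length v"
  shows "mpo_first X L' L (map flip w) (map flip v) = mpo_first X L' L w v"
proof (cases w; cases v)
  fix a w' b v'
  assume wv: "w = a # w'" "v = b # v'"
  then have len: "length w' = length v'" using assms by simp
  have X: "X ** X = mat 1" "\<And>a b. X ** L a b = L (flip a) (flip b) ** X"
    using assms by (auto simp: twist_covariant_def)
  have "X ** (L' a b ** mprod L w' v') = L' (flip a) (flip b) ** mprod L (map flip w') (map flip v') ** X"
    by (simp add: matrix_mul_assoc assms(2))
       (simp add: matrix_mul_assoc[symmetric] mprod_conj[of X L flip, OF X(2) len])
  then show ?thesis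
    by (simp add: wv mpo_first_def trace_cyclic[of X "L' a b ** mprod L w' v'"]
        trace_cyclic[of X "L' (flip a) (flip b) ** mprod L (map flip w') (map flip v')"])
qed (use assms in auto)

text \<open>
  The local relation makes the commutator with a single bond a difference of two kernels that are
  related by the twisted rotation, so that the sum over all bonds telescopes.
\<close>

theorem chain_kernel_mpo_commute:
  fixes L \<Lambda> :: "3 \<Rightarrow> 3 \<Rightarrow> complex^'n^'n"
  assumes N: "N \<ge> 2" and L: "twist_covariant X L"
    and \<Lambda>: "\<And>a b. X ** \<Lambda> a b = \<Lambda> (flip a) (flip b) ** X"
    and loc: "\<And>a b c d. (\<Sum>e\<in>UNIV. \<Sum>f\<in>UNIV. cscale (g a b e f) (L e c ** L f d)) -
      (\<Sum>e\<in>UNIV. \<Sum>f\<in>UNIV. cscale (g e f c d) (L a e ** L b f)) = \<Lambda> a c ** L b d - L a c ** \<Lambda> b d"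
  shows "kmul N (chain_kernel N g) (mpo X L) = kmul N (mpo X L) (chain_kernel N g)"
proof (rule kmul_eqI)
  fix w v :: "3 list"
  assume wv: "w \<in> configs N" "v \<in> configs N"
  define T where "T = mpo X L"
  have Trot: "T ((rot ^^ k) w) ((rot ^^ k) v) = T w v" if "w \<in> configs N" "v \<in> configs N" for w v k
    unfolding T_def using that by (intro mpo_rot_funpow[OF L]) (simp add: configs_def)
  define D where "D = mpo_first X \<Lambda> L"
  have first: "(\<Sum>u\<in>configs N. bond g w u * T u v) - (\<Sum>u\<in>configs N. T w u * bond g u v) =
      D w v - D (rot w) (rot v)" if wv: "w \<in> configs N" "v \<in> configs N" for w v
  proof -
    obtain a b p where w: "w = a # b # p" "p \<in> configs (N - 2)"
      using configs_ge_2E[OF wv(1) N] .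
    obtain c d q where v: "v = c # d # q" "q \<in> configs (N - 2)"
      using configs_ge_2E[OF wv(2) N] .
    have N2: "N = Suc (Suc (N - 2))" using N by simp
    have len: "length p = length q"
      using w v by (simp add: configs_def)
    have A: "(\<Sum>u\<in>configs N. bond g w u * T u v) =
        trace (X ** (\<Sum>e\<in>UNIV. \<Sum>f\<in>UNIV. cscale (g a b e f) (L e c ** L f d)) ** mprod L p q)"
      using w v
      by (subst N2) (simp add: sum_configs_Suc bond_def T_def mpo_def matrix_mult_sum trace_sum
          trace_cscale matrix_mul_assoc if_distrib[of "\<lambda>x. _ * x * _"] mult.assoc of_bool_def sum.delta
          if_distrib[of "\<lambda>x. x * _"] if_distrib[of "\<lambda>x. _ * x"] cong: if_cong)
    have B: "(\<Sum>u\<in>configs N. T w u * bond g u v) =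
        trace (X ** (\<Sum>e\<in>UNIV. \<Sum>f\<in>UNIV. cscale (g e f c d) (L a e ** L b f)) ** mprod L p q)"
      using w v
      by (subst N2) (simp add: sum_configs_Suc bond_def T_def mpo_def matrix_mult_sum trace_sum
          trace_cscale matrix_mul_assoc mult.commute of_bool_def sum.delta'
          if_distrib[of "\<lambda>x. x * _"] if_distrib[of "\<lambda>x. _ * x"] cong: if_cong)
    have X: "X ** X = mat 1" "\<And>a b. X ** L a b = L (flip a) (flip b) ** X"
      using L by (auto simp: twist_covariant_def)
    \<comment> \<open>The rotation puts the defect on the second site and moves the first factor,
      flipped, to the end. Cyclicity and covariance restore it in front of the defect, as the second
      term of \<open>loc\<close>.\<close>
    have "D (rot w) (rot v) = trace ((X ** \<Lambda> b d ** mprod L p q ** L (flip a) (flip c)))"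
      using len by (simp add: D_def mpo_first_def w v mprod_append matrix_mul_assoc)
    also have "\<dots> = trace (L (flip a) (flip c) ** X ** \<Lambda> b d ** mprod L p q)"
      by (subst trace_cyclic) (simp add: matrix_mul_assoc)
    finally have rotD: "D (rot w) (rot v) = trace (X ** (L a c ** \<Lambda> b d) ** mprod L p q)"
      by (simp add: matrix_mul_assoc X(2))
    have D: "D w v = trace (X ** (\<Lambda> a c ** L b d) ** mprod L p q)"
      by (simp add: D_def mpo_first_def w v matrix_mul_assoc)
    show ?thesis
      unfolding A B D rotD trace_sub[symmetric] matrix_diff_mult[symmetric] matrix_mult_diff[symmetric] loc ..
  qed
  \<comment> \<open>Since \<open>T\<close> is invariant under \<open>rot\<close>, each bond can be
    viewed in the rotated frame in which it is the first bond, where \<open>first\<close>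
    applies.\<close>
  have "(\<Sum>u\<in>configs N. chain_kernel N g w u * T u v) =
      (\<Sum>k<N. \<Sum>u\<in>configs N. bond g ((rot ^^ k) w) ((rot ^^ k) u) * T ((rot ^^ k) u) ((rot ^^ k) v))"
    using wv by (simp add: chain_kernel_def sum_distrib_right Trot) (rule sum.swap)
  also have "\<dots> = (\<Sum>k<N. \<Sum>u\<in>configs N. bond g ((rot ^^ k) w) u * T u ((rot ^^ k) v))"
    by (subst sum_rot_funpow) (rule refl)
  finally have 1: "(\<Sum>u\<in>configs N. chain_kernel N g w u * T u v) =
      (\<Sum>k<N. \<Sum>u\<in>configs N. bond g ((rot ^^ k) w) u * T u ((rot ^^ k) v))" .
  have "(\<Sum>u\<in>configs N. T w u * chain_kernel N g u v) =
      (\<Sum>k<N. \<Sum>u\<in>configs N. T ((rot ^^ k) w) ((rot ^^ k) u) * bond g ((rot ^^ k) u) ((rot ^^ k) v))"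
    using wv by (simp add: chain_kernel_def sum_distrib_left Trot) (rule sum.swap)
  also have "\<dots> = (\<Sum>k<N. \<Sum>u\<in>configs N. T ((rot ^^ k) w) u * bond g u ((rot ^^ k) v))"
    by (subst sum_rot_funpow[where f = "\<lambda>u. T _ u * bond g u _"]) (rule refl)
  finally have 2: "(\<Sum>u\<in>configs N. T w u * chain_kernel N g u v) =
      (\<Sum>k<N. \<Sum>u\<in>configs N. T ((rot ^^ k) w) u * bond g u ((rot ^^ k) v))" .
  have "(\<Sum>u\<in>configs N. chain_kernel N g w u * T u v) - (\<Sum>u\<in>configs N. T w u * chain_kernel N g u v) =
      (\<Sum>k<N. D ((rot ^^ k) w) ((rot ^^ k) v) - D (rot ((rot ^^ k) w)) (rot ((rot ^^ k) v)))"
    unfolding 1 2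
    by (subst sum_subtractf[symmetric], intro sum.cong refl first) (use wv in simp_all)
  also have "\<dots> = 0"
    unfolding D_def using wv
    by (intro rot_telescope mpo_first_flip L \<Lambda>) (auto simp: configs_def)
  finally show "(\<Sum>u\<in>configs N. chain_kernel N g w u * mpo X L u v) = (\<Sum>u\<in>configs N. mpo X L w u * chain_kernel N g u v)"
    by (simp add: T_def)
qed

section \<open>The transfer matrix with spin-one-half auxiliary space\<close>

definition twist :: "complex^2^2"
  where "twist = (\<chi> i j. of_bool (i \<noteq> j))"

text \<open>
  The diagonal entries are \<open>sinh (v + m \<eta>) / sinh \<eta>\<close> with \<open>x = 2 cosh \<eta>\<close>, written through
  \<open>p = sinh v / sinh \<eta>\<close> and \<open>t = sinh (v - \<eta>) / sinh \<eta>\<close>, which satisfy \<open>p\<^sup>2 - x p t + t\<^sup>2 = 1\<close>. Rescaling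
  so that \<open>p = 1\<close> turns this constraint into the normalisation \<open>s\<^sup>2 = x (p\<^sup>2 - x p t + t\<^sup>2)\<close> of the
  off-diagonal entry.
\<close>

definition lax :: "complex \<Rightarrow> complex \<Rightarrow> complex \<Rightarrow> complex \<Rightarrow> 3 \<Rightarrow> 3 \<Rightarrow> complex^2^2"
  where "lax x p t s a b = (\<chi> i j.
    if i = j then
      (if a \<noteq> b then 0 else if a = 2 then p else if (a = 1) = (i = 1) then x * p - t else t)
    else if (i = 1 \<and> (a = 2 \<and> b = 1 \<or> a = 3 \<and> b = 2)) \<or>
      (i = 2 \<and> (a = 1 \<and> b = 2 \<or> a = 2 \<and> b = 3)) then s else 0)"

text \<open>With p, t as hyperbolic functions of v, one has cosh v = p x / 2 - t and cosh (v - eta)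
  = p - t x / 2. So the diagonal part is -x sinh eta times the v-derivative of \<open>lax\<close>,
  whose off-diagonal entry is constant in v. The off-diagonal part is the commutator of
  \<open>lax\<close> with a one-site diagonal matrix whose entry at 2 exceeds the others by x^2 / 2.
  It compensates the left-right asymmetry of \<open>bond_weight\<close>.\<close>

definition lax_deriv :: "complex \<Rightarrow> complex \<Rightarrow> complex \<Rightarrow> complex \<Rightarrow> 3 \<Rightarrow> 3 \<Rightarrow> complex^2^2"
  where "lax_deriv x p t s a b = (\<chi> i j.
    if i = j then - x * lax x (p * x / 2 - t) (p - t * x / 2) 0 a b $ i $ j
    else (if a = 2 then 1 else -1) * x\<^sup>2 / 2 * lax x p t s a b $ i $ j)"

text \<open>
  This differs from the two-site interaction in the definition of the Hamiltonian by the diagonal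
  term \<open>D\<^sub>j - D\<^sub>j\<^sub>+\<^sub>1\<close> given by \<open>site_weight\<close> below, which cancels in the sum over the chain.
\<close>

definition bond_weight :: "complex \<Rightarrow> 3 \<Rightarrow> 3 \<Rightarrow> 3 \<Rightarrow> 3 \<Rightarrow> complex"
  where "bond_weight x a b c d =
    (if a = c \<and> b = d then
       (if a = 2 then (if b = 2 then 2 else 1 + x\<^sup>2) else if b = 2 then 1 else if a = b then x\<^sup>2 else 1)
     else if a = d \<and> b = c then (if a = 2 \<or> b = 2 then 1 else -1)
     else if flip a = b \<and> flip c = d then x else 0)"

lemma twist_covariant_lax: "twist_covariant twist (lax x p t s)"
proof -
  have "twist ** lax x p t s a b = lax x p t s (flip a) (flip b) ** twist" for a b
    using exhaust_3[of a] exhaust_3[of b]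
    by (auto simp: twist_def lax_def matrix_matrix_mult_def vec_eq_iff forall_2 sum_2)
  moreover have "twist ** twist = mat 1"
    by (auto simp: twist_def matrix_matrix_mult_def vec_eq_iff forall_2 sum_2 mat_def)
  ultimately show ?thesis
    by (simp add: twist_covariant_def)
qed

lemma twist_lax_deriv:
  "twist ** lax_deriv x p t s a b = lax_deriv x p t s (flip a) (flip b) ** twist"
  using exhaust_3[of a] exhaust_3[of b]
  by (auto simp: twist_def lax_def lax_deriv_def matrix_matrix_mult_def vec_eq_iff forall_2 sum_2)

text \<open>The Sutherland relation, an infinitesimal form of the Yang-Baxter equation. Once
  \<open>s * s\<close> is eliminated by the constraint, each entry is a polynomial identity in x, p,
  t and s.\<close>

lemma lax_local:
  assumes "s * s = x * (p\<^sup>2 - x * p * t + t\<^sup>2)"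
  shows "(\<Sum>e\<in>UNIV. \<Sum>f\<in>UNIV. cscale (bond_weight x a b e f) (lax x p t s e c ** lax x p t s f d)) -
      (\<Sum>e\<in>UNIV. \<Sum>f\<in>UNIV. cscale (bond_weight x e f c d) (lax x p t s a e ** lax x p t s b f)) =
      lax_deriv x p t s a c ** lax x p t s b d - lax x p t s a c ** lax_deriv x p t s b d"
proof -
  have s: "s * s = x * (p * p) - x * (x * (p * t)) + x * (t * t)"
    using assms by (simp add: algebra_simps power2_eq_square)
  have s': "s * (s * z) = x * (p * (p * z)) - x * (x * (p * (t * z))) + x * (t * (t * z))" for z
    using arg_cong[OF s, of "\<lambda>y. y * z"] by (simp add: algebra_simps)
  have entry: "(\<Sum>e\<in>UNIV. \<Sum>f\<in>UNIV. bond_weight x a b e f *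
        (lax x p t s e c $ i $ 1 * lax x p t s f d $ 1 $ j + lax x p t s e c $ i $ 2 * lax x p t s f d $ 2 $ j)) -
      (\<Sum>e\<in>UNIV. \<Sum>f\<in>UNIV. bond_weight x e f c d *
        (lax x p t s a e $ i $ 1 * lax x p t s b f $ 1 $ j + lax x p t s a e $ i $ 2 * lax x p t s b f $ 2 $ j)) =
      (lax_deriv x p t s a c $ i $ 1 * lax x p t s b d $ 1 $ j + lax_deriv x p t s a c $ i $ 2 * lax x p t s b d $ 2 $ j) -
      (lax x p t s a c $ i $ 1 * lax_deriv x p t s b d $ 1 $ j + lax x p t s a c $ i $ 2 * lax_deriv x p t s b d $ 2 $ j)"
    for i j
    using exhaust_3[of a] exhaust_3[of b] exhaust_3[of c] exhaust_3[of d] exhaust_2[of i] exhaust_2[of j]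
    apply (elim disjE)
    apply (simp_all add: sum_3 bond_weight_def lax_def lax_deriv_def)
    apply (simp_all add: s s' field_simps power2_eq_square)
    done
  show ?thesis
    using entry by (simp add: vec_eq_iff cscale_def matrix_matrix_mult_def sum_2)
qed

section \<open>Fusion\<close>

definition twist3 :: "complex^3^3"
  where "twist3 = (\<chi> i j. of_bool (j = flip i))"

text \<open>The 19-vertex spin-one R-matrix, in a gauge with polynomial entries: \<open>g\<close> is
  the square of the off-diagonal Lax entry s. The unequal placement of \<open>x\<close> and
  \<open>g\<close> is the source of the left-right asymmetry of \<open>bond_weight\<close>.\<close>

definition fused :: "complex \<Rightarrow> complex \<Rightarrow> 3 \<Rightarrow> 3 \<Rightarrow> complex^3^3"
  where "fused x t a b = (\<chi> i j. let g = x * (1 - x * t + t\<^sup>2) in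
    if a = b then
      (if i \<noteq> j then 0
       else if i = 2 then (if a = 2 then t + g else t)
       else if a = 2 then t else if a = i then x - t else t * (x * t - 1))
    else if i = b \<and> j = a then (if i = 2 then x else g)
    else if (i, j, a, b) = (1, 2, 3, 2) \<or> (i, j, a, b) = (3, 2, 1, 2) then g * t
    else if (i, j, a, b) = (2, 1, 2, 3) \<or> (i, j, a, b) = (2, 3, 2, 1) then x * t
    else 0)"

definition singlet_col :: "complex^1^(2 \<times> 2)"
  where "singlet_col = (\<chi> i _. if i = (1, 2) then 1 else if i = (2, 1) then -1 else 0)"

definition singlet_row :: "complex^(2 \<times> 2)^1"
  where "singlet_row = (\<chi> _ j. if j = (1, 2) then 1 / 2 else if j = (2, 1) then - 1 / 2 else 0)"

definition triplet_row :: "complex \<Rightarrow> complex \<Rightarrow> complex^(2 \<times> 2)^3"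
  where "triplet_row c d = (\<chi> i j.
    if i = 2 then (if fst j = snd j then 0 else d)
    else if fst j = snd j \<and> (fst j = 1 \<longleftrightarrow> i = 1) then c else 0)"

definition triplet_col :: "complex \<Rightarrow> complex \<Rightarrow> complex^3^(2 \<times> 2)"
  where "triplet_col c d = (\<chi> i j.
    if j = 2 then (if fst i = snd i then 0 else d)
    else if fst i = snd i \<and> (fst i = 1 \<longleftrightarrow> j = 1) then c else 0)"

text \<open>The quantum determinant of the Lax matrix, by which the singlet channel acts at each
  site.\<close>

definition singlet_site :: "complex \<Rightarrow> complex \<Rightarrow> 3 \<Rightarrow> 3 \<Rightarrow> complex^1^1"
  where "singlet_site x t a b = mat (of_bool (a = b) * (t - x * (1 - x * t + t\<^sup>2)))"

lemma sum_2_2: "(\<Sum>k\<in>UNIV. f k) = f (1, 1) + f (1, 2) + f (2, 1) + f (2 :: 2, 2 :: 2)"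
  by (simp add: UNIV_Times_UNIV[symmetric] sum.cartesian_product' sum_2 add.assoc del: UNIV_Times_UNIV)

lemma forall_2_2: "(\<forall>k. P k) \<longleftrightarrow> P (1, 1) \<and> P (1, 2) \<and> P (2, 1) \<and> P (2 :: 2, 2 :: 2)"
  by (auto simp: split_paired_All forall_2)

lemmas matrix_entries = matrix_matrix_mult_def vec_eq_iff forall_2_2 forall_3 forall_2 sum_2_2 sum_3 sum_2
  kron_def mat_def

lemma twist_triplet:
  "triplet_row c d ** kron twist twist = twist3 ** triplet_row c d"
  "kron twist twist ** triplet_col c d = triplet_col c d ** twist3"
  by (simp_all add: matrix_entries triplet_row_def triplet_col_def twist_def twist3_def)

lemma twist_singlet:
  "kron twist twist ** singlet_col = cscale (-1) singlet_col"
  "singlet_row ** kron twist twist = cscale (-1) singlet_row"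
  by (simp_all add: matrix_entries singlet_row_def singlet_col_def twist_def cscale_def)

lemma triplet_singlet_complete:
  assumes "c * c' = 1" "2 * (d * d') = 1"
  shows "triplet_col c d ** triplet_row c' d' + singlet_col ** singlet_row = mat 1"
    "triplet_row c' d' ** triplet_col c d = mat 1" "singlet_row ** singlet_col = mat 1"
proof -
  have nz: "c \<noteq> 0" "d \<noteq> 0"
    using assms by auto
  then have "c' = 1 / c" "d' = 1 / (2 * d)"
    using assms by (simp_all add: eq_divide_eq mult_ac)
  with nz show "triplet_col c d ** triplet_row c' d' + singlet_col ** singlet_row = mat 1"
    "triplet_row c' d' ** triplet_col c d = mat 1" "singlet_row ** singlet_col = mat 1"
    by (simp_all add: matrix_entries triplet_row_def triplet_col_def singlet_row_def singlet_col_def sum_1)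
qed

context
  fixes x t s :: complex
  assumes s: "s * s = x * (1 - x * t + t\<^sup>2)" "s \<noteq> 0"
begin

lemma s_simps:
  "s * s = x - x * (x * t) + x * (t * t)"
  "s * (s * z) = x * z - x * (x * (t * z)) + x * (t * (t * z))"
proof -
  show *: "s * s = x - x * (x * t) + x * (t * t)"
    using s(1) by (simp add: algebra_simps power2_eq_square)
  show "s * (s * z) = x * z - x * (x * (t * z)) + x * (t * (t * z))"
    using arg_cong[OF *, of "\<lambda>y. y * z"] by (simp add: algebra_simps)
qed

text \<open>In this order of the factors the singlet line is invariant and the triplet is a
  quotient. In the opposite order the triplet is an invariant subspace and the singlet a quotient.
  The factors taken at p = 1 and p = t are one shift by eta apart: x t - 1 continues the sequence 1,
  t. The scalings \<open>1, 1 / s\<close> here and \<open>x, s\<close> in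
  \<open>triplet_col_fused\<close> make both orders yield the same \<open>fused\<close>.\<close>

lemma triplet_row_fused:
  "triplet_row 1 (1 / s) ** kron_site (lax x 1 t s) (lax x t (x * t - 1) s) a b =
   fused x t a b ** triplet_row 1 (1 / s)"
  using exhaust_3[of a] exhaust_3[of b]
  apply (elim disjE)
  apply (simp_all add: matrix_entries kron_site_def triplet_row_def fused_def lax_def)
  apply (simp_all add: field_simps power2_eq_square s_simps s(2))
  done

lemma triplet_col_fused:
  "kron_site (lax x t (x * t - 1) s) (lax x 1 t s) a b ** triplet_col x s =
   triplet_col x s ** fused x t a b"
  using exhaust_3[of a] exhaust_3[of b]
  apply (elim disjE)
  apply (simp_all add: matrix_entries kron_site_def triplet_col_def fused_def lax_def)
  apply (simp_all add: field_simps power2_eq_square s_simps s(2))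
  done

lemma singlet_col_site:
  "kron_site (lax x 1 t s) (lax x t (x * t - 1) s) a b ** singlet_col = singlet_col ** singlet_site x t a b"
  using exhaust_3[of a] exhaust_3[of b]
  apply (elim disjE)
  apply (simp_all add: matrix_entries kron_site_def singlet_col_def singlet_site_def lax_def sum_1)
  apply (simp_all add: field_simps power2_eq_square s_simps s(2))
  done

lemma singlet_row_site:
  "singlet_row ** kron_site (lax x t (x * t - 1) s) (lax x 1 t s) a b = singlet_site x t a b ** singlet_row"
  using exhaust_3[of a] exhaust_3[of b]
  apply (elim disjE)
  apply (simp_all add: matrix_entries kron_site_def singlet_row_def singlet_site_def lax_def sum_1)
  apply (simp_all add: field_simps power2_eq_square s_simps s(2))
  done

end

lemma mpo_singlet_site:
  "length w = length v \<Longrightarrow>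
   trace (mprod (singlet_site x t) w v) = (t - x * (1 - x * t + t\<^sup>2)) ^ length w * of_bool (w = v)"
proof (induction w v rule: list_induct2)
  case (Cons a w b v)
  then show ?case
    by (simp add: trace_def singlet_site_def matrix_matrix_mult_def sum_1 mat_def)
qed (simp add: trace_def sum_1 mat_def)

text \<open>The trace of a block triangular matrix is the sum over its diagonal blocks, whichever
  block is invariant. The twist acts as \<open>twist3\<close> on the triplet and as -1 on the
  singlet, hence the minus sign.\<close>

lemma trace_singlet_triplet:
  fixes M :: "complex^(2 \<times> 2)^(2 \<times> 2)"
  assumes "c * c' = 1" "2 * (d * d') = 1"
    and "triplet_row c' d' ** M = M3 ** triplet_row c' d' \<and> M ** singlet_col = singlet_col ** M1 \<or>
      M ** triplet_col c d = triplet_col c d ** M3 \<and> singlet_row ** M = M1 ** singlet_row"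
  shows "trace (kron twist twist ** M) = trace (twist3 ** M3) - trace M1"
proof -
  let ?X = "kron twist twist" and ?P = "triplet_row c' d'" and ?V = "triplet_col c d"
  note complete = triplet_singlet_complete[OF assms(1,2)]
  note twist = twist_triplet twist_singlet
  from assms(3) have "trace (?P ** (?X ** M ** ?V)) = trace (twist3 ** M3) \<and>
      trace (singlet_row ** (?X ** M ** singlet_col)) = - trace M1"
  proof (elim disjE conjE)
    assume M: "?P ** M = M3 ** ?P" "M ** singlet_col = singlet_col ** M1"
    have "?P ** (?X ** M ** ?V) = twist3 ** (?P ** M) ** ?V"
      by (simp add: matrix_mul_assoc twist)
    also have "\<dots> = twist3 ** M3 ** (?P ** ?V)"
      by (simp add: M matrix_mul_assoc)
    finally have 1: "?P ** (?X ** M ** ?V) = twist3 ** M3"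
      by (simp add: complete)
    have "singlet_row ** (?X ** M ** singlet_col) = singlet_row ** ?X ** (M ** singlet_col)"
      by (simp add: matrix_mul_assoc)
    also have "\<dots> = cscale (-1) (singlet_row ** singlet_col ** M1)"
      by (simp add: M twist matrix_mul_assoc)
    finally show ?thesis
      using 1 by (simp add: complete trace_cscale)
  next
    assume M: "M ** ?V = ?V ** M3" "singlet_row ** M = M1 ** singlet_row"
    have "?P ** (?X ** M ** ?V) = ?P ** ?X ** (M ** ?V)"
      by (simp add: matrix_mul_assoc)
    also have "\<dots> = twist3 ** (?P ** ?V) ** M3"
      by (simp add: M twist matrix_mul_assoc)
    finally have 1: "?P ** (?X ** M ** ?V) = twist3 ** M3"
      by (simp add: complete)
    have "singlet_row ** (?X ** M ** singlet_col) = singlet_row ** ?X ** M ** singlet_col"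
      by (simp add: matrix_mul_assoc)
    also have "\<dots> = cscale (-1) (M1 ** (singlet_row ** singlet_col))"
      by (simp add: M twist matrix_mul_assoc)
    finally show ?thesis
      using 1 by (simp add: complete trace_cscale)
  qed
  moreover have "trace (?X ** M) = trace (?X ** M ** (?V ** ?P + singlet_col ** singlet_row))"
    by (simp add: complete)
  moreover have "\<dots> = trace (?X ** M ** ?V ** ?P) + trace (?X ** M ** singlet_col ** singlet_row)"
    by (simp add: matrix_add_ldistrib trace_add matrix_mul_assoc)
  ultimately show ?thesis
    using trace_cyclic[of ?P "?X ** M ** ?V"] trace_cyclic[of singlet_row "?X ** M ** singlet_col"]
    by simp
qed

definition spin_half_transfer :: "complex \<Rightarrow> complex \<Rightarrow> complex \<Rightarrow> complex \<Rightarrow> 3 kernel"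
  where "spin_half_transfer x p t s = mpo twist (lax x p t s)"

text \<open>Evaluating both orders of the product to the same kernel also shows that
  \<open>A\<close> and \<open>B\<close> commute, which \<open>strace_fused\<close> uses in place of
  a Yang-Baxter argument for two spin-1/2 auxiliary spaces.\<close>

lemma fusion:
  assumes s: "s * s = x * (1 - x * t + t\<^sup>2)" "s \<noteq> 0" and x: "x \<noteq> 0"
    and wv: "w \<in> configs N" "v \<in> configs N"
  defines "A \<equiv> spin_half_transfer x 1 t s" and "B \<equiv> spin_half_transfer x t (x * t - 1) s"
  shows "(\<Sum>u\<in>configs N. A w u * B u v) =
      mpo twist3 (fused x t) w v - (t - x * (1 - x * t + t\<^sup>2)) ^ N * of_bool (w = v)" (is ?AB)
    and "(\<Sum>u\<in>configs N. B w u * A u v) =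
      mpo twist3 (fused x t) w v - (t - x * (1 - x * t + t\<^sup>2)) ^ N * of_bool (w = v)" (is ?BA)
proof -
  have len: "length w = length v" "length w = N"
    using wv by (auto simp: configs_def)
  let ?K = "kron_site (lax x 1 t s) (lax x t (x * t - 1) s)"
  have "trace (kron twist twist ** mprod ?K w v) =
      trace (twist3 ** mprod (fused x t) w v) - trace (mprod (singlet_site x t) w v)"
  proof (rule trace_singlet_triplet)
    \<comment> \<open>The column weights are dual to the row weights: \<open>1 * 1 = 1\<close> and
      \<open>2 * ((s / 2) * (1 / s)) = 1\<close>, the 2 counting the two entries of the middle
      triplet vector.\<close>
    show "triplet_row 1 (1 / s) ** mprod ?K w v = mprod (fused x t) w v ** triplet_row 1 (1 / s) \<and>
          mprod ?K w v ** singlet_col = singlet_col ** mprod (singlet_site x t) w v \<or>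
        mprod ?K w v ** triplet_col 1 (s / 2) = triplet_col 1 (s / 2) ** mprod (fused x t) w v \<and>
          singlet_row ** mprod ?K w v = mprod (singlet_site x t) w v ** singlet_row"
      using mprod_intertwine[OF triplet_row_fused[OF s] len(1)]
        mprod_intertwine[OF singlet_col_site[OF s, symmetric] len(1)] by simp
  qed (use s in auto)
  then show ?AB
    using mpo_singlet_site[OF len(1)] len(2)
    unfolding A_def B_def spin_half_transfer_def mpo_product[OF wv] by (simp add: mpo_def)
  let ?K = "kron_site (lax x t (x * t - 1) s) (lax x 1 t s)"
  have "trace (kron twist twist ** mprod ?K w v) =
      trace (twist3 ** mprod (fused x t) w v) - trace (mprod (singlet_site x t) w v)"
  proof (rule trace_singlet_triplet)
    show "triplet_row (1 / x) (1 / (2 * s)) ** mprod ?K w v = mprod (fused x t) w v ** triplet_row (1 / x) (1 / (2 * s)) \<and>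
          mprod ?K w v ** singlet_col = singlet_col ** mprod (singlet_site x t) w v \<or>
        mprod ?K w v ** triplet_col x s = triplet_col x s ** mprod (fused x t) w v \<and>
          singlet_row ** mprod ?K w v = mprod (singlet_site x t) w v ** singlet_row"
      using mprod_intertwine[OF triplet_col_fused[OF s, symmetric] len(1)]
        mprod_intertwine[OF singlet_row_site[OF s] len(1)] by simp
  qed (use s x in auto)
  then show ?BA
    using mpo_singlet_site[OF len(1)] len(2)
    unfolding A_def B_def spin_half_transfer_def mpo_product[OF wv] by (simp add: mpo_def)
qed

section \<open>Parity of the spin-1/2 transfer matrix\<close>

definition grading :: "complex^2^2"
  where "grading = (\<chi> i j. if i = j then if i = 1 then 1 else -1 else 0)"

lemma grading_lax:
  "grading ** lax x p t s a b = cscale (sgn_mag [a] * sgn_mag [b]) (lax x p t s a b ** grading)"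
  using exhaust_3[of a] exhaust_3[of b]
  by (auto simp: grading_def lax_def cscale_def matrix_matrix_mult_def vec_eq_iff forall_2 sum_2)

lemma cscale_cscale [simp]: "cscale c (cscale d A) = cscale (c * d) A"
  by (simp add: cscale_def vec_eq_iff mult.assoc)

lemma cscale_1 [simp]: "cscale 1 A = A"
  by (simp add: cscale_def vec_eq_iff)

lemma grading_mprod:
  "length w = length v \<Longrightarrow>
    grading ** mprod (lax x p t s) w v = cscale (sgn_mag w * sgn_mag v) (mprod (lax x p t s) w v ** grading)"
proof (induction w v rule: list_induct2)
  case (Cons a w b v)
  have "grading ** mprod (lax x p t s) (a # w) (b # v) =
      cscale (sgn_mag [a] * sgn_mag [b]) (lax x p t s a b ** (grading ** mprod (lax x p t s) w v))"
    by (simp add: matrix_mul_assoc grading_lax del: sgn_mag_Cons)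
  then show ?case
    unfolding Cons.IH by (simp add: matrix_mul_assoc mult_ac)
qed simp

text \<open>Diagonal Lax entries preserve the parity of a configuration and off-diagonal ones change
  it, so parity can be traded for conjugation by \<open>grading\<close> in the auxiliary space.
  There it anticommutes with the twist.\<close>

lemma parity_odd_transfer: "parity_odd (spin_half_transfer x p t s)"
  unfolding parity_odd_def spin_half_transfer_def mpo_def
proof (intro allI impI)
  fix w v :: "3 list"
  assume len: "length w = length v"
  let ?M = "mprod (lax x p t s) w v"
  have g: "grading ** grading = mat 1" "grading ** twist = cscale (-1) (twist ** grading)"
    by (auto simp: grading_def twist_def cscale_def mat_def matrix_matrix_mult_def vec_eq_iff forall_2 sum_2)
  have "trace (twist ** ?M) = trace (twist ** ?M ** (grading ** grading))"
    by (simp add: g)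
  also have "\<dots> = trace (grading ** twist ** (?M ** grading))"
    using trace_cyclic[of grading "twist ** ?M ** grading"] by (simp add: matrix_mul_assoc)
  also have "?M ** grading = cscale (sgn_mag w * sgn_mag v) (grading ** ?M)"
    by (simp add: grading_mprod[OF len]) (simp add: mult_ac flip: mult.assoc)
  also have "trace (grading ** twist ** cscale (sgn_mag w * sgn_mag v) (grading ** ?M)) =
      - (sgn_mag w * sgn_mag v) * trace (twist ** (grading ** grading) ** ?M)"
    by (simp add: g(2) trace_cscale matrix_mul_assoc)
  finally have *: "trace (twist ** ?M) = - (sgn_mag w * sgn_mag v) * trace (twist ** ?M)"
    unfolding g matrix_mul_rid .
  have "sgn_mag w * trace (twist ** ?M) = - (sgn_mag w * sgn_mag w) * sgn_mag v * trace (twist ** ?M)"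
    using arg_cong[OF *, of "\<lambda>z. sgn_mag w * z"] by (simp only: mult_minus_left mult_minus_right mult.assoc)
  then show "sgn_mag w * trace (twist ** ?M) = - (trace (twist ** ?M) * sgn_mag v)"
    by simp
qed

lemma strace_fused:
  assumes s: "s * s = x * (1 - x * t + t\<^sup>2)" "s \<noteq> 0" and x: "x \<noteq> 0"
    and Y: "kmul N Y (spin_half_transfer x 1 t s) = kmul N (spin_half_transfer x 1 t s) Y"
  shows "(\<Sum>w\<in>configs N. \<Sum>v\<in>configs N. sgn_mag w *
      (mpo twist3 (fused x t) w v - (t - x * (1 - x * t + t\<^sup>2)) ^ N * of_bool (w = v)) * Y v w) = 0"
proof -
  let ?A = "spin_half_transfer x 1 t s" and ?B = "spin_half_transfer x t (x * t - 1) s"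
  have "kmul N ?A ?B = kmul N ?B ?A"
    by (rule kmul_eqI) (simp only: fusion[OF s x])
  from strace_product_odd[OF parity_odd_transfer this Y] show ?thesis
    by (simp add: strace_kmul kmul_def fusion[OF s x] cong: sum.cong)
qed

section \<open>The Hamiltonian from the fused transfer matrix\<close>

text \<open>The Leibniz rule for \<open>mprod\<close>; the value 0 on empty lists is the derivative
  of the constant \<open>mat 1\<close>.\<close>

fun dprod :: "('a \<Rightarrow> 'a \<Rightarrow> complex^'n^'n) \<Rightarrow> ('a \<Rightarrow> 'a \<Rightarrow> complex^'n^'n) \<Rightarrow> 'a list \<Rightarrow> 'a list \<Rightarrow> complex^'n^'n"
  where "dprod L' L (a # w) (b # v) = L' a b ** mprod L w v + L a b ** dprod L' L w v"
  | "dprod L' L _ _ = 0"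

lemma has_field_derivative_mprod:
  fixes L :: "complex \<Rightarrow> 'a \<Rightarrow> 'a \<Rightarrow> complex^'n^'n"
  assumes "\<And>a b i j. ((\<lambda>t. L t a b $ i $ j) has_field_derivative L' a b $ i $ j) (at t0)"
    and "length w = length v"
  shows "((\<lambda>t. mprod (L t) w v $ i $ j) has_field_derivative dprod L' (L t0) w v $ i $ j) (at t0)"
  using assms(2)
proof (induction w v arbitrary: i j rule: list_induct2)
  case (Cons a w b v)
  have "((\<lambda>t. \<Sum>k\<in>UNIV. L t a b $ i $ k * mprod (L t) w v $ k $ j) has_field_derivative
      (\<Sum>k\<in>UNIV. L' a b $ i $ k * mprod (L t0) w v $ k $ j + L t0 a b $ i $ k * dprod L' (L t0) w v $ k $ j)) (at t0)"
    by (rule DERIV_sum) (auto intro!: derivative_eq_intros assms(1) Cons.IH)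
  then show ?case
    by (simp add: matrix_matrix_mult_def sum.distrib)
qed simp

text \<open>The k-th term of the Leibniz rule has its defect on site k, and k twisted rotations
  bring it to the front.\<close>

lemma trace_dprod:
  assumes L: "twist_covariant X L" and "length w = length v"
  shows "trace (X ** dprod L' L w v) = (\<Sum>k<length w. mpo_first X L' L ((rot ^^ k) w) ((rot ^^ k) v))"
proof -
  have X: "X ** X = mat 1" "\<And>a b. X ** L a b = L (flip a) (flip b) ** X"
    using L by (auto simp: twist_covariant_def)
  \<comment> \<open>Generalised over the sites \<open>p\<close>, \<open>q\<close> already passed:
    they stand before the defect on the left, and flipped at the end of the chain on the
    right.\<close>
  have "trace (X ** mprod L p q ** dprod L' L w v) =
      (\<Sum>k<length w. mpo_first X L' L ((rot ^^ k) (w @ map flip p)) ((rot ^^ k) (v @ map flip q)))"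
    if "length p = length q" for p q
    using assms(2) that
  proof (induction w v arbitrary: p q rule: list_induct2)
    case (Cons a w b v)
    have pull: "X ** mprod L p q = mprod L (map flip p) (map flip q) ** X"
      by (rule mprod_conj[of X L flip, OF X(2) Cons.prems])
    \<comment> \<open>The added factors \<open>X\<close>, whose square is 1, conjugate the prefix so
      that it can be replaced by its flipped form behind the defect.\<close>
    have "trace (X ** mprod L p q ** (L' a b ** mprod L w v)) =
        trace (X ** (L' a b ** mprod L w v) ** (X ** mprod L p q ** X ** X ** X))"
      (is "?l = trace ?r")
    proof -
      have r: "?r = X ** (L' a b ** mprod L w v ** X ** mprod L p q ** X)"
        using X(1) by (simp add: matrix_mul_assoc[symmetric])
      have "trace ?r = trace ((L' a b ** mprod L w v ** X ** mprod L p q ** X) ** X)"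
        unfolding r by (rule trace_cyclic)
      also have "\<dots> = trace (L' a b ** mprod L w v ** X ** mprod L p q ** (X ** X))"
        by (simp only: matrix_mul_assoc)
      also have "\<dots> = ?l"
        using trace_cyclic[of "L' a b ** mprod L w v" "X ** mprod L p q"] by (simp add: X matrix_mul_assoc)
      finally show ?thesis by simp
    qed
    also have "X ** mprod L p q ** X ** X ** X = mprod L (map flip p) (map flip q)"
      unfolding pull by (simp add: matrix_mul_assoc[symmetric] X(1))
    finally have first: "trace (X ** mprod L p q ** (L' a b ** mprod L w v)) =
        mpo_first X L' L ((a # w) @ map flip p) ((b # v) @ map flip q)"
      using Cons.hyps by (simp add: mpo_first_def mprod_append matrix_mul_assoc)
    have "trace (X ** mprod L p q ** (L a b ** dprod L' L w v)) =
        trace (X ** mprod L (p @ [a]) (q @ [b]) ** dprod L' L w v)"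
      using Cons.prems by (simp add: mprod_append matrix_mul_assoc)
    also have "\<dots> = (\<Sum>k<length w. mpo_first X L' L ((rot ^^ k) (rot ((a # w) @ map flip p))) ((rot ^^ k) (rot ((b # v) @ map flip q))))"
      using Cons.IH[of "p @ [a]" "q @ [b]"] Cons.prems by simp
    finally show ?case
      unfolding dprod.simps matrix_add_ldistrib trace_add first
      by (simp add: sum.lessThan_Suc_shift funpow_Suc_right del: funpow.simps sum.lessThan_Suc)
  qed (simp add: trace_def)
  from this[of "[]" "[]"] show ?thesis by simp
qed

text \<open>The derivative of \<open>fused\<close> at t = 0. With the outgoing legs interchanged, so
  that (i, a) goes to (b, j), it is the two-site interaction up to a multiple of the
  identity.\<close>

definition fused_deriv :: "complex \<Rightarrow> 3 \<Rightarrow> 3 \<Rightarrow> complex^3^3"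
  where "fused_deriv x a b = (\<chi> i j. bond_weight x i a b j - (1 + x\<^sup>2) * of_bool (i = b \<and> a = j))"

lemma has_field_derivative_fused:
  "((\<lambda>t. fused x t a b $ i $ j) has_field_derivative fused_deriv x a b $ i $ j) (at 0)"
  using exhaust_3[of a] exhaust_3[of b] exhaust_3[of i] exhaust_3[of j]
  by (elim disjE)
    (auto simp: fused_def fused_deriv_def bond_weight_def Let_def power2_eq_square intro!: derivative_eq_intros)

lemma fused_0: "fused x 0 a b $ i $ j = x * of_bool (i = b \<and> j = a)"
  using exhaust_3[of a] exhaust_3[of b] exhaust_3[of i] exhaust_3[of j]
  by (elim disjE) (simp_all add: fused_def)

text \<open>At t = 0 each site is x times the permutation: it emits the incoming auxiliary letter
  and passes its own letter on to the next site.\<close>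

lemma mprod_fused_0:
  "length w = length v \<Longrightarrow> mprod (fused x 0) w v $ i $ j = x ^ length w * of_bool (i # w = v @ [j])"
proof (induction w v arbitrary: i j rule: list_induct2)
  case (Cons a w b v)
  have "mprod (fused x 0) (a # w) (b # v) $ i $ j =
      (\<Sum>k\<in>UNIV. x * of_bool (i = b \<and> k = a) * (x ^ length w * of_bool (k # w = v @ [j])))"
    by (simp add: matrix_matrix_mult_def fused_0 Cons)
  also have "\<dots> = (\<Sum>k\<in>UNIV. if k = a then x ^ length (a # w) * of_bool (i # a # w = (b # v) @ [j]) else 0)"
    by (intro sum.cong) auto
  finally show ?case by simp
qed (simp add: mat_def)

lemma twist_covariant_fused: "twist_covariant twist3 (fused x t)"
proof -
  have "twist3 ** fused x t a b = fused x t (flip a) (flip b) ** twist3" for a b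
    using exhaust_3[of a] exhaust_3[of b]
    by (elim disjE) (simp_all add: twist3_def fused_def matrix_matrix_mult_def vec_eq_iff forall_3 sum_3)
  moreover have "twist3 ** twist3 = mat 1"
    by (simp add: twist3_def matrix_matrix_mult_def vec_eq_iff forall_3 sum_3 mat_def)
  ultimately show ?thesis
    by (simp add: twist_covariant_def)
qed

lemma trace_twist3: "trace (twist3 ** A) = (\<Sum>i\<in>UNIV. A $ flip i $ i)"
  by (simp add: trace_def twist3_def matrix_matrix_mult_def of_bool_def
      if_distrib[of "\<lambda>y. y * _"] cong: if_cong)

text \<open>Closing the shift of letters with \<open>twist3\<close> flips the letter that wraps
  around. So the operator at t = 0 is \<open>x ^ N\<close> times the inverse of
  \<open>rot_kernel\<close>.\<close>

lemma mpo_fused_0_rot: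
  assumes "w \<in> configs N" "v \<in> configs N" "N > 0"
  shows "mpo twist3 (fused x 0) (rot w) v = x ^ N * of_bool (w = v)"
proof (cases w)
  case (Cons a u)
  have "mpo twist3 (fused x 0) (rot w) v = (\<Sum>i\<in>UNIV. x ^ N * of_bool (flip i # rot w = v @ [i]))"
    using assms by (simp add: mpo_def trace_twist3 mprod_fused_0 configs_def)
  also have "\<dots> = (\<Sum>i\<in>UNIV. if i = flip a then x ^ N * of_bool (w = v) else 0)"
    using Cons by (intro sum.cong) auto
  finally show ?thesis by simp
qed (use assms in \<open>auto simp: configs_def\<close>)

lemma mpo_first_fused_rot:
  assumes "w \<in> configs N" "v \<in> configs N" "N \<ge> 2"
  shows "mpo_first twist3 (fused_deriv x) (fused x 0) (rot w) v =
    x ^ (N - 1) * (bond (bond_weight x) w v - (1 + x\<^sup>2) * of_bool (w = v))"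
proof -
  obtain a b u where w: "w = a # b # u" "u \<in> configs (N - 2)"
    using configs_ge_2E[OF assms(1,3)] .
  obtain c d q where v: "v = c # d # q" "q \<in> configs (N - 2)"
    using configs_ge_2E[OF assms(2,3)] .
  have len: "length (u @ [flip a]) = length (d # q)" "length (u @ [flip a]) = N - 1"
    using w v assms by (auto simp: configs_def)
  have "mpo_first twist3 (fused_deriv x) (fused x 0) (rot w) v =
      (\<Sum>i\<in>UNIV. \<Sum>k\<in>UNIV. fused_deriv x b c $ flip i $ k * (x ^ (N - 1) * of_bool (k # u @ [flip a] = (d # q) @ [i])))"
    by (simp only: w v rot.simps mpo_first_def trace_twist3 append_Cons list.case prod.case
        ) (simp only: matrix_matrix_mult_def vec_lambda_beta mprod_fused_0[OF len(1)] len(2) append_Cons)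
  \<comment> \<open>The list equation leaves one choice of auxiliary letters and forces the
    remaining sites to agree, so only the first bond survives.\<close>
  also have "\<dots> = (\<Sum>i\<in>UNIV. \<Sum>k\<in>UNIV. if k = d then if i = flip a then
      fused_deriv x b c $ a $ d * (x ^ (N - 1) * of_bool (u = q)) else 0 else 0)"
    by (intro sum.cong) auto
  also have "\<dots> = fused_deriv x b c $ a $ d * (x ^ (N - 1) * of_bool (u = q))"
    by simp
  finally show ?thesis
    by (auto simp: w v bond_def fused_deriv_def of_bool_def)
qed

lemma trace_dprod_fused_rot:
  assumes "w \<in> configs N" "v \<in> configs N" "N \<ge> 2"
  shows "trace (twist3 ** dprod (fused_deriv x) (fused x 0) (rot w) v) =
    x ^ (N - 1) * (chain_kernel N (bond_weight x) w v - of_nat N * (1 + x\<^sup>2) * of_bool (w = v))"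
proof -
  have "trace (twist3 ** dprod (fused_deriv x) (fused x 0) (rot w) v) =
      (\<Sum>k<N. mpo_first twist3 (fused_deriv x) (fused x 0) (rot ((rot ^^ k) w)) ((rot ^^ k) v))"
    using assms(1,2) trace_dprod[OF twist_covariant_fused, of "rot w" v "fused_deriv x" x 0]
    by (simp add: configs_def funpow_swap1)
  also have "\<dots> = (\<Sum>k<N. x ^ (N - 1) * (bond (bond_weight x) ((rot ^^ k) w) ((rot ^^ k) v) - (1 + x\<^sup>2) * of_bool (w = v)))"
    using assms by (intro sum.cong refl) (simp add: mpo_first_fused_rot)
  finally show ?thesis
    by (simp add: chain_kernel_def sum_distrib_left[symmetric] sum_subtractf)
qed

section \<open>Vanishing supertraces of powers of the chain kernel\<close>

definition kpow :: "nat \<Rightarrow> 'a::finite kernel \<Rightarrow> nat \<Rightarrow> 'a kernel"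
  where "kpow N A k = (kmul N A ^^ k) (\<lambda>w v. of_bool (w = v))"

lemma kpow_0: "kpow N A 0 = (\<lambda>w v. of_bool (w = v))"
  and kpow_Suc: "kpow N A (Suc k) = kmul N A (kpow N A k)"
  by (simp_all add: kpow_def)

lemma kmul_id_commute:
  "kmul N (\<lambda>w v. of_bool (w = v)) T = kmul N T (\<lambda>w v. of_bool (w = v))"
  by (rule kmul_eqI) (simp add: of_bool_def if_distrib[of "\<lambda>y. y * _"] if_distrib[of "\<lambda>y. _ * y"] cong: if_cong)

lemma kpow_commute:
  assumes "kmul N A T = kmul N T A"
  shows "kmul N (kpow N A k) T = kmul N T (kpow N A k)"
proof (induction k)
  case (Suc k)
  then show ?case
    by (simp add: kpow_Suc kmul_assoc) (simp add: kmul_assoc[symmetric] assms)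
qed (simp add: kpow_0 kmul_id_commute)

definition rot_kernel :: "3 kernel"
  where "rot_kernel w v = of_bool (rot w = v)"

lemma rot_kernel_commute:
  assumes "twist_covariant X L"
  shows "kmul N rot_kernel (mpo X L) = kmul N (mpo X L) rot_kernel"
proof (rule kmul_eqI)
  fix w v :: "3 list"
  assume wv: "w \<in> configs N" "v \<in> configs N"
  then obtain v' where v': "v = rot v'" "v' \<in> configs N"
    using bij_betw_imp_surj_on[OF bij_rot, of N] by auto
  have "(\<Sum>u\<in>configs N. rot_kernel w u * mpo X L u v) = mpo X L (rot w) (rot v')"
    using wv v' by (simp add: rot_kernel_def of_bool_def if_distrib[of "\<lambda>y. y * _"] cong: if_cong)
  also have "\<dots> = mpo X L w v'"
    using wv v' by (intro mpo_rot[OF assms]) (simp add: configs_def)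
  also have "\<dots> = (\<Sum>u\<in>configs N. mpo X L w u * rot_kernel u v)"
    using wv v' by (simp add: rot_kernel_def of_bool_def if_distrib[of "\<lambda>y. _ * y"] cong: if_cong)
  finally show "(\<Sum>u\<in>configs N. rot_kernel w u * mpo X L u v) = (\<Sum>u\<in>configs N. mpo X L w u * rot_kernel u v)" .
qed

lemma kmul_rot_kernel:
  assumes "v \<in> configs N" "w \<in> configs N"
  shows "kmul N Z rot_kernel v (rot w) = Z v w"
  using assms
  by (simp add: kmul_def rot_kernel_def of_bool_def if_distrib[of "\<lambda>y. _ * y"] cong: if_cong)

lemma strace_chain_kernel_kmul:
  assumes x: "x \<noteq> 0" and N: "N \<ge> 2"
    and Z: "\<And>t s. s * s = x * (1 - x * t + t\<^sup>2) \<Longrightarrow> kmul N Z (spin_half_transfer x 1 t s) = kmul N (spin_half_transfer x 1 t s) Z"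
  shows "strace N (kmul N (chain_kernel N (bond_weight x)) Z) = 0"
proof -
  \<comment> \<open>The factor \<open>rot_kernel\<close> undoes the inverse translation of the fused
    operator and commutes with the transfer matrix, as \<open>Z\<close> does.\<close>
  define Y where "Y = kmul N Z rot_kernel"
  define \<delta> where "\<delta> = (\<lambda>t. t - x * (1 - x * t + t\<^sup>2))"
  define U where "U = (\<lambda>t w v. mpo twist3 (fused x t) w v - \<delta> t ^ N * of_bool (w = v))"
  define U' where "U' = (\<lambda>w v. trace (twist3 ** dprod (fused_deriv x) (fused x 0) w v) -
    of_nat N * (1 + x\<^sup>2) * \<delta> 0 ^ (N - 1) * of_bool (w = v))"
  define f where "f = (\<lambda>t. \<Sum>w\<in>configs N. \<Sum>v\<in>configs N. sgn_mag w * U t (rot w) v * Z v w)"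
  have comm: "kmul N Y (spin_half_transfer x 1 t s) = kmul N (spin_half_transfer x 1 t s) Y"
    if "s * s = x * (1 - x * t + t\<^sup>2)" for t s
    by (simp add: Y_def kmul_assoc rot_kernel_commute[OF twist_covariant_lax] spin_half_transfer_def)
       (simp add: kmul_assoc[symmetric] Z[OF that, unfolded spin_half_transfer_def])
  \<comment> \<open>The condition makes s nonzero, as fusion requires. It holds in a neighbourhood
    of 0, so both \<open>f\<close> and its derivative vanish at 0.\<close>
  have f0: "f t = 0" if "1 - x * t + t\<^sup>2 \<noteq> 0" for t
  proof -
    define s where "s = csqrt (x * (1 - x * t + t\<^sup>2))"
    have s: "s * s = x * (1 - x * t + t\<^sup>2)"
      using power2_csqrt[of "x * (1 - x * t + t\<^sup>2)"] by (simp add: s_def power2_eq_square)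
    with that x have "s \<noteq> 0" by auto
    from strace_fused[OF s this x comm[OF s]]
    have "(\<Sum>w\<in>configs N. \<Sum>v\<in>configs N. sgn_mag w * U t w v * Y v w) = 0"
      by (simp add: U_def \<delta>_def)
    also have "(\<Sum>w\<in>configs N. \<Sum>v\<in>configs N. sgn_mag w * U t w v * Y v w) =
        (\<Sum>w\<in>configs N. \<Sum>v\<in>configs N. sgn_mag (rot w) * U t (rot w) v * Y v (rot w))"
      by (rule sum_rot[symmetric])
    finally show ?thesis
      by (simp add: f_def Y_def kmul_rot_kernel cong: sum.cong)
  qed
  have U: "((\<lambda>t. U t w v) has_field_derivative U' w v) (at 0)" if "w \<in> configs N" "v \<in> configs N" for w v
  proof -
    have "((\<lambda>t. mpo twist3 (fused x t) w v) has_field_derivative trace (twist3 ** dprod (fused_deriv x) (fused x 0) w v)) (at 0)"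
      unfolding mpo_def trace_twist3 using that
      by (intro DERIV_sum has_field_derivative_mprod has_field_derivative_fused) (simp add: configs_def)
    moreover have "((\<lambda>t. \<delta> t ^ N * of_bool (w = v)) has_field_derivative
        of_nat N * (1 + x\<^sup>2) * \<delta> 0 ^ (N - 1) * of_bool (w = v)) (at 0)"
      unfolding \<delta>_def by (auto intro!: derivative_eq_intros simp: power2_eq_square)
    ultimately show ?thesis
      unfolding U_def U'_def by (rule DERIV_diff)
  qed
  define f' where "f' = (\<Sum>w\<in>configs N. \<Sum>v\<in>configs N. sgn_mag w * U' (rot w) v * Z v w)"
  have "(f has_field_derivative f') (at 0)"
    unfolding f_def f'_def by (intro DERIV_sum DERIV_cmult DERIV_cmult_right U) auto
  moreover have "(f has_field_derivative 0) (at 0)"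
  proof -
    have "((\<lambda>t. 1 - x * t + t\<^sup>2) \<longlongrightarrow> 1 - x * 0 + 0\<^sup>2) (nhds 0)"
      by (intro tendsto_intros filterlim_ident)
    then have "eventually (\<lambda>t. 1 - x * t + t\<^sup>2 \<noteq> 0) (nhds 0)"
      by (rule tendsto_imp_eventually_ne) simp
    then have "eventually (\<lambda>t. f t = 0) (nhds 0)"
      by eventually_elim (rule f0)
    then show ?thesis
      by (subst DERIV_cong_ev[OF refl _ refl]) auto
  qed
  ultimately have f': "f' = 0"
    by (rule DERIV_unique)
  have "f 0 = 0"
    by (rule f0) simp
  \<comment> \<open>Minus the logarithmic derivative of \<open>\<delta> t ^ N\<close> at 0. Since
    \<open>\<delta> 0 = - x\<close>, adding \<open>c\<close> times the value cancels both the
    quantum determinant term and the shift of the bonds by 1 + x^2.\<close>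
  define c where "c = of_nat N * (1 + x\<^sup>2) / x"
  obtain n where n: "N = Suc n" using N by (cases N) auto
  have comb: "U' (rot w) v + c * U 0 (rot w) v = x ^ (N - 1) * chain_kernel N (bond_weight x) w v"
    if "w \<in> configs N" "v \<in> configs N" for w v
  proof -
    have d: "\<delta> 0 = - x" by (simp add: \<delta>_def)
    show ?thesis
      using N x that
      by (simp add: U'_def U_def trace_dprod_fused_rot mpo_fused_0_rot d c_def)
        (simp add: n field_simps)
  qed
  have "0 = f' + c * f 0"
    by (simp add: f' \<open>f 0 = 0\<close>)
  also have "\<dots> = (\<Sum>w\<in>configs N. \<Sum>v\<in>configs N. sgn_mag w * (U' (rot w) v + c * U 0 (rot w) v) * Z v w)"
    by (simp add: f_def f'_def sum_distrib_left sum.distrib[symmetric] algebra_simps)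
  also have "\<dots> = x ^ (N - 1) * strace N (kmul N (chain_kernel N (bond_weight x)) Z)"
    by (simp add: comb strace_kmul sum_distrib_left mult_ac cong: sum.cong)
  finally show ?thesis
    using x by simp
qed

lemma transfer_chain_commute:
  assumes "N \<ge> 2" "s * s = x * (p\<^sup>2 - x * p * t + t\<^sup>2)"
  shows "kmul N (chain_kernel N (bond_weight x)) (spin_half_transfer x p t s) =
    kmul N (spin_half_transfer x p t s) (chain_kernel N (bond_weight x))"
  unfolding spin_half_transfer_def
  using chain_kernel_mpo_commute[OF assms(1) twist_covariant_lax twist_lax_deriv lax_local[OF assms(2)]] .

lemma strace_chain_kernel_power_nonzero:
  assumes "x \<noteq> 0" "N \<ge> 2"
  shows "strace N (kpow N (chain_kernel N (bond_weight x)) (Suc k)) = 0"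
  unfolding kpow_Suc
  by (intro strace_chain_kernel_kmul assms kpow_commute transfer_chain_commute) simp

lemma isCont_kpow:
  fixes A :: "complex \<Rightarrow> 3 kernel"
  assumes "\<And>w v. isCont (\<lambda>x. A x w v) x0"
  shows "isCont (\<lambda>x. kpow N (A x) k w v) x0"
proof (induction k arbitrary: w v)
  case (Suc k)
  then show ?case
    by (cases "w \<in> configs N \<and> v \<in> configs N") (auto simp: kpow_Suc kmul_def intro!: continuous_intros assms)
qed (simp add: kpow_0)

lemma isCont_chain_kernel: "isCont (\<lambda>x. chain_kernel N (bond_weight x) w v) x0"
proof -
  have g: "isCont (\<lambda>x. bond_weight x a b c d) x0" for a b c d
    using exhaust_3[of a] exhaust_3[of b] exhaust_3[of c] exhaust_3[of d]
    by (elim disjE) (simp_all add: bond_weight_def)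
  have "isCont (\<lambda>x. bond (bond_weight x) w v) x0" for w v
    by (cases w; cases "tl w"; cases v; cases "tl v") (auto simp: bond_def intro!: continuous_intros g)
  then show ?thesis
    unfolding chain_kernel_def by (intro continuous_intros)
qed

theorem strace_chain_kernel_power:
  assumes "N \<ge> 2"
  shows "strace N (kpow N (chain_kernel N (bond_weight x)) (Suc k)) = 0"
proof -
  let ?f = "\<lambda>x. strace N (kpow N (chain_kernel N (bond_weight x)) (Suc k))"
  have "isCont ?f x"
    unfolding strace_def by (intro continuous_intros isCont_kpow isCont_chain_kernel)
  then have "(?f \<longlongrightarrow> ?f x) (at x)"
    by (simp add: isCont_def)
  moreover have "eventually (\<lambda>y. ?f y = 0) (at x)"
  proof (cases "x = 0")
    case True
    then show ?thesis
      using assms by (auto simp: eventually_at_filter strace_chain_kernel_power_nonzero)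
  next
    case False
    then show ?thesis
      using assms by (intro eventually_mono[OF tendsto_imp_eventually_ne[OF tendsto_ident_at, of x 0]])
        (auto simp: strace_chain_kernel_power_nonzero)
  qed
  then have "(?f \<longlongrightarrow> 0) (at x)"
    by (rule tendsto_eventually)
  ultimately show ?thesis
    by (rule LIM_unique)
qed

section \<open>Spectral projections of Hermitian kernels\<close>

definition kact :: "nat \<Rightarrow> 3 kernel \<Rightarrow> spin_state \<Rightarrow> spin_state"
  where "kact N A \<psi> w = (if w \<in> configs N then \<Sum>v\<in>configs N. A w v * \<psi> v else 0)"

lemma chain_space_iff: "\<psi> \<in> chain_space N \<longleftrightarrow> (\<forall>w. w \<notin> configs N \<longrightarrow> \<psi> w = 0)"
  by (simp add: chain_space_def configs_def)

lemma kact_in_chain_space [simp]: "kact N A \<psi> \<in> chain_space N"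
  by (simp add: chain_space_iff kact_def)

lemma subspace_chain_space: "chain.subspace (chain_space N)"
  by (simp add: chain.subspace_def chain_space_iff scaleC_def)

lemma kact_kmul: "kact N (kmul N A B) \<psi> = kact N A (kact N B \<psi>)"
  by (rule ext) (auto simp: kact_def kmul_def sum_distrib_left sum_distrib_right mult.assoc intro: sum.swap)

lemma kact_affine:
  assumes "\<psi> \<in> chain_space N"
  shows "kact N (\<lambda>w v. a * of_bool (w = v) + A w v) \<psi> = a *\<^sub>C \<psi> + kact N A \<psi>"
  using assms
  by (auto simp: kact_def fun_eq_iff scaleC_def chain_space_iff distrib_right sum.distrib of_bool_def
      if_distrib[of "\<lambda>y. y * _"] if_distrib[of "\<lambda>y. _ * y"] cong: if_cong)

lemma kact_add: "kact N A (\<phi> + \<psi>) = kact N A \<phi> + kact N A \<psi>"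
  by (auto simp: kact_def fun_eq_iff distrib_left sum.distrib)

lemma kact_scaleC: "kact N A (c *\<^sub>C \<psi>) = c *\<^sub>C kact N A \<psi>"
  by (auto simp: kact_def fun_eq_iff scaleC_def sum_distrib_left mult_ac)

lemma kact_zero [simp]: "kact N A 0 = 0"
  by (auto simp: kact_def fun_eq_iff)

lemma kact_sum: "kact N A (\<Sum>i\<in>I. f i) = (\<Sum>i\<in>I. kact N A (f i))"
proof (induction I rule: infinite_finite_induct)
  case (infinite I)
  show ?case
    unfolding sum.infinite[OF infinite] by (rule kact_zero)
next
  case empty
  show ?case
    unfolding sum.empty by (rule kact_zero)
next
  case (insert x F)
  then show ?case
    unfolding sum.insert[OF insert(1,2)] by (simp only: kact_add)
qed

definition basis_state :: "3 list \<Rightarrow> spin_state"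
  where "basis_state w = (\<lambda>v. of_bool (v = w))"

lemma basis_state_in_chain_space [simp]: "w \<in> configs N \<Longrightarrow> basis_state w \<in> chain_space N"
  by (auto simp: chain_space_iff basis_state_def)

lemma basis_state_expansion:
  assumes "\<psi> \<in> chain_space N"
  shows "\<psi> = (\<Sum>w\<in>configs N. \<psi> w *\<^sub>C basis_state w)"
proof
  fix v
  show "\<psi> v = (\<Sum>w\<in>configs N. \<psi> w *\<^sub>C basis_state w) v"
    using assms by (auto simp: sum_fun_apply scaleC_def basis_state_def chain_space_iff of_bool_def
        if_distrib[of "\<lambda>y. _ * y"] cong: if_cong)
qed

lemma kact_basis_state: "w \<in> configs N \<Longrightarrow> v \<in> configs N \<Longrightarrow> kact N A (basis_state v) w = A w v"
  by (simp add: kact_def basis_state_def of_bool_def if_distrib[of "\<lambda>y. _ * y"] cong: if_cong)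

lemma chain_space_span: "chain_space N \<subseteq> chain.span (basis_state ` configs N)"
proof
  fix \<psi> assume "\<psi> \<in> chain_space N"
  then have "\<psi> = (\<Sum>w\<in>configs N. \<psi> w *\<^sub>C basis_state w)"
    by (rule basis_state_expansion)
  also have "\<dots> \<in> chain.span (basis_state ` configs N)"
    by (intro chain.span_sum chain.span_scale chain.span_base) auto
  finally show "\<psi> \<in> chain.span (basis_state ` configs N)" .
qed

lemma independent_chain_space_bound:
  assumes "chain.independent B" "B \<subseteq> chain_space N"
  shows "finite B" "card B \<le> card (configs N :: 3 list set)"
proof -
  have "finite B \<and> card B \<le> card (basis_state ` (configs N :: 3 list set))"
    using assms chain_space_span by (intro chain.independent_span_bound) auto
  then show "finite B" "card B \<le> card (configs N :: 3 list set)"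
    using card_image_le[of "configs N :: 3 list set" basis_state] by auto
qed

text \<open>Expand the columns of \<open>P\<close> in a basis of \<open>W\<close>. For a basis
  vector b, the b-coordinates of the columns, weighted by the entries of b, add up to the
  b-coordinate of \<open>P\<close> applied to b, which is 1. So the trace counts the basis.\<close>

lemma trace_projection:
  assumes W: "chain.subspace W" "W \<subseteq> chain_space N"
    and into: "\<And>\<psi>. \<psi> \<in> chain_space N \<Longrightarrow> kact N P \<psi> \<in> W"
    and fixed: "\<And>\<psi>. \<psi> \<in> W \<Longrightarrow> kact N P \<psi> = \<psi>"
  shows "of_nat (chain.dim W) = (\<Sum>w\<in>configs N. P w w)"
proof -
  obtain B where B: "B \<subseteq> W" "chain.independent B" "W \<subseteq> chain.span B" "card B = chain.dim W"
    using chain.basis_exists .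
  have fin: "finite B"
    using independent_chain_space_bound(1)[OF B(2)] B(1) W(2) by blast
  let ?r = "chain.representation B"
  have entry: "P w v = (\<Sum>b\<in>B. ?r (kact N P (basis_state v)) b * b w)"
    if "w \<in> configs N" "v \<in> configs N" for w v
  proof -
    have "kact N P (basis_state v) \<in> chain.span B"
      using into that B(3) by auto
    then have "(\<Sum>b\<in>B. ?r (kact N P (basis_state v)) b *\<^sub>C b) = kact N P (basis_state v)"
      by (rule chain.sum_representation_eq[OF B(2) _ fin order_refl])
    then show ?thesis
      using kact_basis_state[OF that, of P] by (metis (no_types, lifting) sum_fun_apply scaleC_def sum.cong)
  qed
  have coeff: "(\<Sum>w\<in>configs N. b w * ?r (kact N P (basis_state w)) b) = 1" if b: "b \<in> B" for b
  proof -
    have bV: "b \<in> chain_space N" and bW: "b \<in> W"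
      using b B(1) W(2) by auto
    have span: "kact N P (basis_state w) \<in> chain.span B" if "w \<in> configs N" for w
      using into that B(3) by auto
    have "b = kact N P (\<Sum>w\<in>configs N. b w *\<^sub>C basis_state w)"
      using fixed[OF bW] basis_state_expansion[OF bV] by simp
    also have "\<dots> = (\<Sum>w\<in>configs N. b w *\<^sub>C kact N P (basis_state w))"
      by (simp add: kact_sum kact_scaleC)
    finally have "?r b b = ?r (\<Sum>w\<in>configs N. b w *\<^sub>C kact N P (basis_state w)) b"
      by simp
    also have "\<dots> = (\<Sum>w\<in>configs N. ?r (b w *\<^sub>C kact N P (basis_state w)) b)"
      by (subst chain.representation_sum[OF B(2)]) (auto intro: chain.span_scale span)
    also have "\<dots> = (\<Sum>w\<in>configs N. b w * ?r (kact N P (basis_state w)) b)"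
      by (intro sum.cong refl) (simp add: chain.representation_scale[OF B(2)] span)
    finally show ?thesis
      using chain.representation_basis[OF B(2) b] by simp
  qed
  have "(\<Sum>w\<in>configs N. P w w) = (\<Sum>w\<in>configs N. \<Sum>b\<in>B. b w * ?r (kact N P (basis_state w)) b)"
    by (intro sum.cong refl) (simp add: entry mult.commute)
  also have "\<dots> = (\<Sum>b\<in>B. 1)"
    by (subst sum.swap) (simp add: coeff)
  finally show ?thesis
    using B(4) by simp
qed

section \<open>Polynomials in a kernel, by Horner's scheme\<close>

definition poly_kernel :: "nat \<Rightarrow> 3 kernel \<Rightarrow> complex poly \<Rightarrow> 3 kernel"
  where "poly_kernel N h p =
    fold_coeffs (\<lambda>a K w v. a * of_bool (w = v) + kmul N h K w v) p (\<lambda>_ _. 0)"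

lemma poly_kernel_0 [simp]: "poly_kernel N h 0 = (\<lambda>_ _. 0)"
  by (simp add: poly_kernel_def)

lemma poly_kernel_pCons:
  "poly_kernel N h (pCons a p) = (\<lambda>w v. a * of_bool (w = v) + kmul N h (poly_kernel N h p) w v)"
proof (cases "p = 0 \<and> a = 0")
  case True
  then show ?thesis by (auto simp: kmul_def fun_eq_iff)
next
  case False
  then show ?thesis by (auto simp: poly_kernel_def)
qed

context
  fixes N :: nat and h :: "3 kernel"
begin

definition pact :: "complex poly \<Rightarrow> spin_state \<Rightarrow> spin_state"
  where "pact p = kact N (poly_kernel N h p)"

lemma pact_0 [simp]: "pact 0 \<psi> = 0"
  by (auto simp: pact_def kact_def)

lemma pact_pCons:
  assumes "\<psi> \<in> chain_space N"
  shows "pact (pCons a p) \<psi> = a *\<^sub>C \<psi> + kact N h (pact p \<psi>)"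
  by (simp add: pact_def poly_kernel_pCons kact_affine[OF assms] kact_kmul)

lemma pact_in_chain_space [simp]: "pact p \<psi> \<in> chain_space N"
  by (simp add: pact_def)

lemma pact_zero [simp]: "pact p 0 = 0"
  by (simp add: pact_def)

lemma pact_add: "\<psi> \<in> chain_space N \<Longrightarrow> pact (p + q) \<psi> = pact p \<psi> + pact q \<psi>"
  by (induction p q rule: poly_induct2)
    (simp_all add: pact_pCons kact_add chain.scale_left_distrib)

lemma pact_smult: "\<psi> \<in> chain_space N \<Longrightarrow> pact (smult c p) \<psi> = c *\<^sub>C pact p \<psi>"
  by (induction p) (simp_all add: pact_pCons kact_scaleC chain.scale_right_distrib)

lemma pact_mult: "\<psi> \<in> chain_space N \<Longrightarrow> pact (p * q) \<psi> = pact p (pact q \<psi>)"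
proof (induction p)
  case (pCons a p)
  then show ?case
    by (simp add: mult_pCons_left pact_add pact_smult pact_pCons)
qed simp

lemma pact_sum: "\<psi> \<in> chain_space N \<Longrightarrow> pact (\<Sum>i\<in>I. f i) \<psi> = (\<Sum>i\<in>I. pact (f i) \<psi>)"
  by (induction I rule: infinite_finite_induct) (simp_all add: pact_add)

lemma pact_monom:
  assumes "\<psi> \<in> chain_space N"
  shows "pact (monom c i) \<psi> = c *\<^sub>C (kact N h ^^ i) \<psi>"
  by (induction i) (simp_all add: monom_0 monom_Suc pact_pCons[OF assms] kact_scaleC)

lemma pact_1: "\<psi> \<in> chain_space N \<Longrightarrow> pact 1 \<psi> = \<psi>"
  by (simp add: one_pCons pact_pCons)

lemma pact_linear_factor:
  "\<psi> \<in> chain_space N \<Longrightarrow> pact [:-E, 1:] \<psi> = kact N h \<psi> - E *\<^sub>C \<psi>"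
  by (simp add: pact_pCons)

lemma pact_eigenvector:
  assumes "\<psi> \<in> chain_space N" "kact N h \<psi> = E *\<^sub>C \<psi>"
  shows "pact p \<psi> = poly p E *\<^sub>C \<psi>"
  by (induction p) (simp_all add: pact_pCons[OF assms(1)] kact_scaleC assms(2) chain.scale_left_distrib mult.commute)

lemma annihilating_poly_vector:
  assumes \<psi>: "\<psi> \<in> chain_space N"
  shows "\<exists>q. q \<noteq> 0 \<and> pact q \<psi> = 0"
proof -
  define n where "n = card (configs N :: 3 list set)"
  define v where "v i = (kact N h ^^ i) \<psi>" for i
  have v: "v i \<in> chain_space N" for i
    using \<psi> by (cases i) (simp_all add: v_def)
  show ?thesis
  \<comment> \<open>Linear dependence is a notion for sets, so coinciding iterates need their own
    polynomial, a difference of two monomials.\<close>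
  proof (cases "inj_on v {..n}")
    case True
    have "card (v ` {..n}) > n"
      using True by (simp add: card_image)
    then have "chain.dependent (v ` {..n})"
      using independent_chain_space_bound(2)[of "v ` {..n}" N] v by (auto simp: n_def)
    then obtain u where u: "\<exists>y\<in>v ` {..n}. u y \<noteq> 0" "(\<Sum>y\<in>v ` {..n}. u y *\<^sub>C y) = 0"
      by (auto simp: chain.dependent_finite)
    define q where "q = (\<Sum>i\<le>n. monom (u (v i)) i)"
    obtain i where i: "i \<le> n" "u (v i) \<noteq> 0"
      using u(1) by auto
    have "coeff q i = u (v i)"
      using i by (simp add: q_def coeff_sum)
    then have "q \<noteq> 0"
      using i by auto
    moreover have "pact q \<psi> = 0"
      using u(2) by (simp add: q_def pact_sum[OF \<psi>] pact_monom[OF \<psi>] v_def[symmetric] sum.reindex[OF True])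
    ultimately show ?thesis by blast
  next
    case False
    then obtain i j where ij: "i \<noteq> j" "v i = v j"
      by (auto simp: inj_on_def)
    define q :: "complex poly" where "q = monom 1 i + smult (-1) (monom 1 j)"
    have "coeff q i = 1"
      using ij by (simp add: q_def)
    then have "q \<noteq> 0" by auto
    moreover have "pact q \<psi> = 0"
      using ij(2) unfolding q_def by (simp only: pact_add[OF \<psi>] pact_smult[OF \<psi>] pact_monom[OF \<psi>] v_def[symmetric])
        simp
    ultimately show ?thesis by blast
  qed
qed

text \<open>The product of annihilating polynomials of the basis states kills every basis state,
  because polynomials in \<open>h\<close> commute.\<close>

lemma annihilating_poly:
  obtains q where "q \<noteq> 0" "\<And>\<psi>. \<psi> \<in> chain_space N \<Longrightarrow> pact q \<psi> = 0"
proof -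
  obtain f where f: "f w \<noteq> 0" "pact (f w) (basis_state w) = 0" if "w \<in> configs N" for w
    using annihilating_poly_vector[OF basis_state_in_chain_space] by metis
  define q where "q = (\<Prod>w\<in>configs N. f w)"
  have q: "pact q (basis_state w) = 0" if "w \<in> configs N" for w
  proof -
    have "q = (\<Prod>w\<in>configs N - {w}. f w) * f w"
      unfolding q_def using that by (simp add: prod.remove mult.commute)
    then show ?thesis
      using that f by (simp add: pact_mult)
  qed
  show ?thesis
  proof
    show "q \<noteq> 0"
      using f by (simp add: q_def)
    show "pact q \<psi> = 0" if "\<psi> \<in> chain_space N" for \<psi>
    proof -
      have "pact q \<psi> = (\<Sum>w\<in>configs N. \<psi> w *\<^sub>C pact q (basis_state w))"
        by (subst basis_state_expansion[OF that]) (simp add: pact_def kact_sum kact_scaleC)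
      then show ?thesis
        by (simp add: q)
    qed
  qed
qed

end

section \<open>Hermitian kernels\<close>

definition ker_inner :: "nat \<Rightarrow> spin_state \<Rightarrow> spin_state \<Rightarrow> complex"
  where "ker_inner N \<phi> \<psi> = (\<Sum>w\<in>configs N. cnj (\<phi> w) * \<psi> w)"

lemma ker_inner_self_eq_0:
  assumes "\<psi> \<in> chain_space N" "ker_inner N \<psi> \<psi> = 0"
  shows "\<psi> = 0"
proof
  fix w
  have "complex_of_real (\<Sum>w\<in>configs N. (cmod (\<psi> w))\<^sup>2) = 0"
    using assms(2) by (simp add: ker_inner_def complex_norm_square mult.commute del: of_real_power)
  then have "(\<Sum>w\<in>configs N. (cmod (\<psi> w))\<^sup>2) = 0"
    using of_real_eq_0_iff by blast
  then show "\<psi> w = 0 w"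
    using assms(1) by (cases "w \<in> configs N") (auto simp: sum_nonneg_eq_0_iff chain_space_iff)
qed

lemma ker_inner_linear:
  "ker_inner N (\<phi> - \<phi>') \<psi> = ker_inner N \<phi> \<psi> - ker_inner N \<phi>' \<psi>"
  "ker_inner N (c *\<^sub>C \<phi>) \<psi> = cnj c * ker_inner N \<phi> \<psi>"
  "ker_inner N \<phi> (c *\<^sub>C \<psi>) = c * ker_inner N \<phi> \<psi>"
  by (simp_all add: ker_inner_def scaleC_def algebra_simps sum_subtractf sum_distrib_left)

context
  fixes N :: nat and h :: "3 kernel"
  assumes herm: "\<And>w v. w \<in> configs N \<Longrightarrow> v \<in> configs N \<Longrightarrow> h v w = cnj (h w v)"
begin

lemma kact_hermitian: "ker_inner N (kact N h \<phi>) \<psi> = ker_inner N \<phi> (kact N h \<psi>)"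
proof -
  have "ker_inner N (kact N h \<phi>) \<psi> = (\<Sum>w\<in>configs N. \<Sum>v\<in>configs N. cnj (h w v) * cnj (\<phi> v) * \<psi> w)"
    unfolding ker_inner_def by (intro sum.cong refl) (simp add: kact_def sum_distrib_right)
  also have "\<dots> = (\<Sum>v\<in>configs N. \<Sum>w\<in>configs N. cnj (\<phi> v) * (h v w * \<psi> w))"
    by (subst sum.swap, intro sum.cong refl) (simp add: herm[symmetric] mult.left_commute)
  also have "\<dots> = ker_inner N \<phi> (kact N h \<psi>)"
    unfolding ker_inner_def by (intro sum.cong refl) (simp add: kact_def sum_distrib_left)
  finally show ?thesis .
qed

text \<open>
  Replaces diagonalisability: generalised eigenvectors of a Hermitian kernel are eigenvectors.
\<close>

lemma hermitian_generalized_eigenvector: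
  assumes u: "u \<in> chain_space N"
    and v: "kact N h (kact N h u - E *\<^sub>C u) = E *\<^sub>C (kact N h u - E *\<^sub>C u)"
  shows "kact N h u = E *\<^sub>C u"
proof -
  define y where "y = kact N h u - E *\<^sub>C u"
  have y: "kact N h y = E *\<^sub>C y" "y \<in> chain_space N"
    using u v by (auto simp: y_def intro: chain.subspace_diff[OF subspace_chain_space]
        chain.subspace_scale[OF subspace_chain_space])
  \<comment> \<open>Either E is not real, and then its eigenvector y vanishes; or E is real, and
    then y = (h - E) u is orthogonal to itself because h - E is Hermitian and kills y.\<close>
  have "E * ker_inner N y y = cnj E * ker_inner N y y"
    using kact_hermitian[of y y] by (simp only: y(1) ker_inner_linear)
  then have "E = cnj E \<or> ker_inner N y y = 0"
    by (simp only: mult_cancel_right) blast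
  moreover have "ker_inner N y y = (E - cnj E) * ker_inner N u y"
    using kact_hermitian[of u y]
    by (subst (1) y_def) (simp add: ker_inner_linear y(1) left_diff_distrib)
  moreover have "E - cnj E = 0" if "E = cnj E"
    using that by (simp only: right_minus_eq)
  ultimately have "ker_inner N y y = 0"
    by (metis mult_zero_left)
  then have "y = 0"
    by (rule ker_inner_self_eq_0[OF y(2)])
  then show ?thesis
    by (simp add: y_def)
qed

lemma pact_linear_factor_power:
  assumes "u \<in> chain_space N" "pact N h ([:-E, 1:] ^ m) u = 0"
  shows "kact N h u = E *\<^sub>C u"
  using assms
proof (induction m arbitrary: u)
  case 0
  then have "u = 0"
    using pact_1[OF 0(1), of h] by (simp only: power_0)
  then show ?case
    by (simp only: kact_zero chain.scale_zero_right)
next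
  case (Suc m)
  define y where "y = kact N h u - E *\<^sub>C u"
  have y: "y \<in> chain_space N"
    using Suc.prems(1) by (auto simp: y_def intro: chain.subspace_diff[OF subspace_chain_space]
        chain.subspace_scale[OF subspace_chain_space])
  have "pact N h ([:-E, 1:] ^ m) y = 0"
    using Suc.prems(2)
    by (simp only: power_Suc2 pact_mult[OF Suc.prems(1)] pact_linear_factor[OF Suc.prems(1)] y_def)
  from Suc.IH[OF y this] show ?case
    unfolding y_def by (rule hermitian_generalized_eigenvector[OF Suc.prems(1)])
qed

text \<open>Split off from an annihilating polynomial the full power of the factor with root E and
  keep the cofactor r. What r(h) produces is killed by a power of h - E, hence by h - E
  itself.\<close>

lemma spectral_projection_poly:
  obtains r where "poly r E \<noteq> 0"
    "\<And>\<psi>. \<psi> \<in> chain_space N \<Longrightarrow> kact N h (pact N h r \<psi>) = E *\<^sub>C pact N h r \<psi>"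
proof -
  obtain q where q: "q \<noteq> 0" "\<And>\<psi>. \<psi> \<in> chain_space N \<Longrightarrow> pact N h q \<psi> = 0"
    by (rule annihilating_poly[of N h]) blast
  obtain r where r: "q = [:-E, 1:] ^ order E q * r" "\<not> [:-E, 1:] dvd r"
    using order_decomp[OF q(1)] by blast
  show ?thesis
  proof
    show "poly r E \<noteq> 0"
      using r(2) by (simp add: poly_eq_0_iff_dvd)
    show "kact N h (pact N h r \<psi>) = E *\<^sub>C pact N h r \<psi>" if "\<psi> \<in> chain_space N" for \<psi>
    proof (rule pact_linear_factor_power)
      show "pact N h ([:-E, 1:] ^ order E q) (pact N h r \<psi>) = 0"
        using q(2)[OF that] by (subst (asm) r(1)) (simp only: pact_mult[OF that])
    qed simp
  qed
qed

end

lemma kmul_cong_right_sum: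
  "kmul N A (\<lambda>w v. a * B w v + C w v) = (\<lambda>w v. a * kmul N A B w v + kmul N A C w v)"
  by (auto simp: kmul_def fun_eq_iff distrib_left sum.distrib sum_distrib_left mult_ac)

lemma strace_add_scale:
  "strace N (\<lambda>w v. a * A w v + B w v) = a * strace N A + strace N B"
  by (simp add: strace_def distrib_left sum.distrib sum_distrib_left mult_ac)

text \<open>The leading positive power of \<open>h\<close> excludes a constant term. Each
  coefficient peeled off \<open>p\<close> feeds one more \<open>h\<close> into that power, so the
  induction needs all k at once.\<close>

lemma strace_poly_kernel:
  assumes "\<And>k. strace N (kpow N h (Suc k)) = 0"
  shows "strace N (kmul N (kpow N h (Suc k)) (poly_kernel N h p)) = 0"
proof (induction p arbitrary: k)
  case 0
  show ?case by (simp add: strace_def kmul_def)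
next
  case (pCons a p)
  have id: "kmul N (kpow N h (Suc k)) (\<lambda>w v. of_bool (w = v)) = kpow N h (Suc k)"
    by (auto simp: kpow_Suc kmul_def fun_eq_iff of_bool_def if_distrib[of "\<lambda>y. _ * y"] cong: if_cong)
  have "kmul N (kpow N h (Suc k)) h = kpow N h (Suc (Suc k))"
    by (simp add: kpow_Suc kmul_assoc kpow_commute[OF refl])
  then have "kmul N (kpow N h (Suc k)) (kmul N h (poly_kernel N h p)) =
      kmul N (kpow N h (Suc (Suc k))) (poly_kernel N h p)"
    by (simp add: kmul_assoc[symmetric])
  then show ?case
    using pCons.IH[of "Suc k"]
    by (simp add: poly_kernel_pCons kmul_cong_right_sum strace_add_scale id assms)
qed

theorem eigenspace_dim_eq:
  assumes herm: "\<And>w v. w \<in> configs N \<Longrightarrow> v \<in> configs N \<Longrightarrow> h v w = cnj (h w v)"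
    and even: "\<And>w v. w \<in> configs N \<Longrightarrow> v \<in> configs N \<Longrightarrow> sgn_mag w * h w v = h w v * sgn_mag v"
    and str: "\<And>k. strace N (kpow N h (Suc k)) = 0"
    and E: "E \<noteq> 0"
  shows "chain.dim (eigenspace_on (parity_sector N 1) (kact N h) E) =
    chain.dim (eigenspace_on (parity_sector N (-1)) (kact N h) E)"
proof -
  obtain r where r: "poly r E \<noteq> 0"
    "\<And>\<psi>. \<psi> \<in> chain_space N \<Longrightarrow> kact N h (pact N h r \<psi>) = E *\<^sub>C pact N h r \<psi>"
    using spectral_projection_poly[of N h E, OF herm] by blast
  \<comment> \<open>Normalises h r(h) to act as the identity on the eigenspace of E. The extra
    factor h removes the constant term, and it is here that E must not be 0.\<close>
  define c where "c = 1 / (E * poly r E)"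
  define P where "P = (\<lambda>w v. c * kmul N h (poly_kernel N h r) w v)"
  have P: "kact N P \<psi> = (c * E) *\<^sub>C pact N h r \<psi>" if "\<psi> \<in> chain_space N" for \<psi>
  proof -
    have "kact N P \<psi> = c *\<^sub>C kact N (kmul N h (poly_kernel N h r)) \<psi>"
      by (auto simp: P_def kact_def scaleC_def fun_eq_iff sum_distrib_left mult.assoc)
    then show ?thesis
      by (simp add: kact_kmul pact_def[symmetric] r(2)[OF that])
  qed
  have P_eigen: "kact N h (kact N P \<psi>) = E *\<^sub>C kact N P \<psi>" if "\<psi> \<in> chain_space N" for \<psi>
    by (simp add: P[OF that] kact_scaleC r(2)[OF that] mult.commute)
  have P_fix: "kact N P \<psi> = \<psi>" if "\<psi> \<in> chain_space N" "kact N h \<psi> = E *\<^sub>C \<psi>" for \<psi>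
    using E r(1) by (simp add: P[OF that(1)] pact_eigenvector[OF that] c_def)
  have "strace N P = c * strace N (kmul N h (poly_kernel N h r))"
    by (simp add: P_def strace_def sum_distrib_left mult_ac)
  also have "strace N (kmul N h (poly_kernel N h r)) = strace N (kmul N (kpow N h (Suc 0)) (poly_kernel N h r))"
    by (auto simp: strace_def kmul_def kpow_Suc kpow_0 of_bool_def if_distrib[of "\<lambda>y. _ * y"] cong: if_cong)
  finally have strP: "strace N P = 0"
    using strace_poly_kernel[OF str] by simp
  define W where "W \<sigma> = eigenspace_on (parity_sector N \<sigma>) (kact N h) E" for \<sigma>
  \<comment> \<open>Projection to the sector after projection to the eigenspace. Since
    \<open>h\<close> is even, the result stays in the eigenspace, and the two traces differ by the
    supertrace of \<open>P\<close>.\<close>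
  define R where "R \<sigma> = (\<lambda>w v. (1 + \<sigma> * sgn_mag w) / 2 * P w v)" for \<sigma>
  have W_iff: "\<psi> \<in> W \<sigma> \<longleftrightarrow> \<psi> \<in> chain_space N \<and> (\<forall>w. sgn_mag w * \<psi> w = \<sigma> * \<psi> w) \<and> kact N h \<psi> = E *\<^sub>C \<psi>" for \<psi> \<sigma>
    by (auto simp: W_def eigenspace_on_def parity_sector_def parity_op_def sgn_mag_def scaleC_def fun_eq_iff)
  have dim: "of_nat (chain.dim (W \<sigma>)) = (\<Sum>w\<in>configs N. R \<sigma> w w)" if \<sigma>: "\<sigma> * \<sigma> = 1" for \<sigma>
  proof (rule trace_projection[where P = "R \<sigma>"])
    show "chain.subspace (W \<sigma>)"
    proof (rule chain.subspaceI)
      show "0 \<in> W \<sigma>"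
        using chain.subspace_0[OF subspace_chain_space, of N]
        by (simp only: W_iff kact_zero chain.scale_zero_right) simp
      show "\<phi> + \<psi> \<in> W \<sigma>" if "\<phi> \<in> W \<sigma>" "\<psi> \<in> W \<sigma>" for \<phi> \<psi>
        using that chain.subspace_add[OF subspace_chain_space, of \<phi> N \<psi>]
        by (simp only: W_iff kact_add chain.scale_right_distrib plus_fun_apply distrib_left simp_thms)
      show "c *\<^sub>C \<psi> \<in> W \<sigma>" if "\<psi> \<in> W \<sigma>" for c \<psi>
        using that chain.subspace_scale[OF subspace_chain_space, of \<psi> N c]
        by (simp only: W_iff kact_scaleC chain.scale_left_commute[of E c])
          (simp add: scaleC_def mult.left_commute[of _ c])
    qed
    show "W \<sigma> \<subseteq> chain_space N"
      by (auto simp: W_iff)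
    define q where "q w = (1 + \<sigma> * sgn_mag w) / 2" for w
    have q_sgn: "sgn_mag w * q w = \<sigma> * q w" for w
    proof -
      have "sgn_mag w * q w = (sgn_mag w + \<sigma> * (sgn_mag w * sgn_mag w)) / 2"
        by (simp only: q_def times_divide_eq_right distrib_left mult_1_right mult.left_commute)
      also have "\<dots> = (\<sigma> + \<sigma> * \<sigma> * sgn_mag w) / 2"
        by (simp only: sgn_mag_square \<sigma> mult_1_right mult_1_left add.commute)
      also have "\<dots> = \<sigma> * q w"
        by (simp only: q_def times_divide_eq_right distrib_left mult_1_right mult.assoc)
      finally show ?thesis .
    qed
    have q_even: "h w v * q v = q w * h w v" if "w \<in> configs N" "v \<in> configs N" for w v
    proof -
      have "h w v * q v = (h w v + \<sigma> * (h w v * sgn_mag v)) / 2"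
        by (simp only: q_def times_divide_eq_right distrib_left mult_1_right mult.left_commute)
      also have "\<dots> = (h w v + \<sigma> * (sgn_mag w * h w v)) / 2"
        by (simp only: even[OF that])
      also have "\<dots> = q w * h w v"
        by (simp only: q_def times_divide_eq_left distrib_right mult_1_left mult.assoc)
      finally show ?thesis .
    qed
    have R: "kact N (R \<sigma>) \<psi> w = q w * kact N P \<psi> w" for \<psi> w
      by (simp only: R_def q_def[symmetric] kact_def sum_distrib_left mult.assoc if_distrib[of "\<lambda>y. _ * y"] mult_zero_right)
    show "kact N (R \<sigma>) \<psi> \<in> W \<sigma>" if "\<psi> \<in> chain_space N" for \<psi>
    proof -
      have "sgn_mag w * kact N (R \<sigma>) \<psi> w = \<sigma> * kact N (R \<sigma>) \<psi> w" for w
        by (simp only: R q_sgn mult.assoc[symmetric])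
      moreover have "kact N h (kact N (R \<sigma>) \<psi>) = E *\<^sub>C kact N (R \<sigma>) \<psi>"
      proof (rule ext)
        fix w
        show "kact N h (kact N (R \<sigma>) \<psi>) w = (E *\<^sub>C kact N (R \<sigma>) \<psi>) w"
      proof (cases "w \<in> configs N")
        case True
        have "kact N h (kact N (R \<sigma>) \<psi>) w = (\<Sum>v\<in>configs N. q w * (h w v * kact N P \<psi> v))"
          unfolding kact_def[of N h] R mult.assoc[symmetric]
          using True by (simp only: q_even if_True cong: sum.cong)
        also have "\<dots> = q w * kact N h (kact N P \<psi>) w"
          using True by (simp only: kact_def[of N h] sum_distrib_left if_True)
        finally show ?thesis
          by (simp only: P_eigen[OF that] R scaleC_def mult.left_commute[of E])
      next
        case False
        then show ?thesis by (simp add: kact_def scaleC_def)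
      qed
      qed
      ultimately show ?thesis
        unfolding W_iff using kact_in_chain_space by blast
    qed
    show "kact N (R \<sigma>) \<psi> = \<psi>" if "\<psi> \<in> W \<sigma>" for \<psi>
    proof (rule ext)
      fix w
      note \<psi> = that[unfolded W_iff]
      have P\<psi>: "kact N P \<psi> = \<psi>"
        using \<psi> by (intro P_fix) blast+
      have sgn: "sgn_mag w * \<psi> w = \<sigma> * \<psi> w"
        using \<psi> by blast
      have "q w * \<psi> w = (\<psi> w + \<sigma> * (sgn_mag w * \<psi> w)) / 2"
        by (simp only: q_def times_divide_eq_left distrib_right mult_1_left mult.assoc)
      also have "\<dots> = (\<psi> w + \<sigma> * \<sigma> * \<psi> w) / 2"
        by (simp only: sgn mult.assoc)
      finally show "kact N (R \<sigma>) \<psi> w = \<psi> w"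
        by (simp only: R P\<psi> \<sigma> mult_1_left) simp
    qed
  qed
  have "of_nat (chain.dim (W 1)) - of_nat (chain.dim (W (-1))) = (\<Sum>w\<in>configs N. R 1 w w - R (-1) w w)"
    by (simp add: dim sum_subtractf)
  also have "\<dots> = strace N P"
    unfolding strace_def by (intro sum.cong refl) (simp add: R_def field_simps)
  finally have "(of_nat (chain.dim (W 1)) :: complex) = of_nat (chain.dim (W (-1)))"
    by (simp add: strP)
  then show ?thesis
    by (simp add: W_def)
qed

section \<open>Identification of the Hamiltonian\<close>

definition bond_term :: "nat \<Rightarrow> real \<Rightarrow> nat \<Rightarrow> spin_state \<Rightarrow> spin_state"
  where "bond_term N x j \<psi> = (let s = twisted_spin N in
     (\<Sum>a\<in>UNIV. complex_of_real (coupling_J x $ a) *\<^sub>C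
        (s a j (s a (j + 1) \<psi>) + 2 *\<^sub>C s a j (s a j \<psi>)))
     - (\<Sum>a\<in>UNIV. \<Sum>b\<in>UNIV. complex_of_real (coupling_A x $ a $ b) *\<^sub>C
          s a j (s b j (s a (j + 1) (s b (j + 1) \<psi>)))))"

lemma hamiltonian_bond_terms: "hamiltonian N x \<psi> = (\<Sum>j<N. bond_term N x j \<psi>)"
  by (simp only: hamiltonian_def bond_term_def Let_def)

lemma twisted_spin_in_chain_space: "\<psi> \<in> chain_space N \<Longrightarrow> twisted_spin N a j \<psi> \<in> chain_space N"
  by (auto simp: twisted_spin_def site_op_def scaleC_def chain_space_def)

lemma hamiltonian_in_chain_space:
  assumes "\<psi> \<in> chain_space N"
  shows "hamiltonian N x \<psi> \<in> chain_space N"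
  unfolding hamiltonian_bond_terms bond_term_def Let_def
  by (intro chain.subspace_sum[OF subspace_chain_space] chain.subspace_diff[OF subspace_chain_space]
      chain.subspace_add[OF subspace_chain_space] chain.subspace_scale[OF subspace_chain_space]
      twisted_spin_in_chain_space assms)

definition shifted :: "nat \<Rightarrow> spin_state \<Rightarrow> spin_state \<Rightarrow> bool"
  where "shifted N \<phi> \<psi> \<longleftrightarrow> (\<forall>w\<in>configs N. \<phi> w = \<psi> (rot w))"

lemma shifted_closed:
  "shifted N \<phi> \<psi> \<Longrightarrow> shifted N (c *\<^sub>C \<phi>) (c *\<^sub>C \<psi>)"
  "shifted N \<phi> \<psi> \<Longrightarrow> shifted N \<phi>' \<psi>' \<Longrightarrow> shifted N (\<phi> + \<phi>') (\<psi> + \<psi>')"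
  "shifted N \<phi> \<psi> \<Longrightarrow> shifted N \<phi>' \<psi>' \<Longrightarrow> shifted N (\<phi> - \<phi>') (\<psi> - \<psi>')"
  "(\<And>i. i \<in> I \<Longrightarrow> shifted N (f i) (g i)) \<Longrightarrow> shifted N (\<Sum>i\<in>I. f i) (\<Sum>i\<in>I. g i)"
  by (auto simp: shifted_def scaleC_def sum_fun_apply)

lemma spin_matrix_flip:
  "spin_matrix a $ flip i $ flip k = (if a = 1 then 1 else -1) * spin_matrix a $ i $ k"
  using exhaust_3[of a] exhaust_3[of i] exhaust_3[of k]
  by (elim disjE) (simp_all add: spin_matrix_def)

lemma sum_flip: "(\<Sum>k\<in>UNIV. f (flip k)) = (\<Sum>k\<in>UNIV. f k)"
  by (simp add: sum_3 add_ac)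

text \<open>Pulling a state back along \<open>rot\<close> moves a spin operator one site to the
  right, including the step from the last site to the twisted copy of site 0.\<close>

lemma shifted_twisted_spin:
  assumes "shifted N \<phi> \<psi>" "j < N"
  shows "shifted N (twisted_spin N a (j + 1) \<phi>) (twisted_spin N a j \<psi>)"
  unfolding shifted_def
proof
  fix w :: "3 list"
  assume w: "w \<in> configs N"
  then obtain b u where u: "w = b # u" "length u = N - 1"
    using assms(2) by (cases w) (auto simp: configs_def)
  show "twisted_spin N a (j + 1) \<phi> w = twisted_spin N a j \<psi> (rot w)"
  proof (cases "j + 1 < N")
    case True
    have "\<phi> (w[Suc j := k]) = \<psi> ((rot w)[j := k])" for k
    proof -
      have "w[Suc j := k] \<in> configs N"
        using w by (simp add: configs_def)
      moreover have "rot (w[Suc j := k]) = (rot w)[j := k]"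
        using list_update_append1[of j u "[flip b]" k] u True by simp
      ultimately show ?thesis
        using assms(1) by (metis shifted_def)
    qed
    then show ?thesis
      using u True by (simp add: twisted_spin_def site_op_def nth_append)
  next
    case False
    \<comment> \<open>Here site j + 1 is the twisted copy: its sign is absorbed by flipping both
      indices of the spin matrix, just as \<open>rot\<close> flips the letter carried
      across.\<close>
    then have j: "j = length u" using u assms(2) by simp
    have "\<phi> (w[0 := k]) = \<psi> ((rot w)[j := flip k])" for k
    proof -
      have "w[0 := k] \<in> configs N"
        using w by (simp add: configs_def)
      moreover have "rot (w[0 := k]) = (rot w)[j := flip k]"
        unfolding u(1) j by simp
      ultimately show ?thesis
        using assms(1) by (metis shifted_def)
    qed
    then have "twisted_spin N a (j + 1) \<phi> w =
        (\<Sum>k\<in>UNIV. spin_matrix a $ flip b $ flip k * \<psi> ((rot w)[j := flip k]))"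
      using u False
      by (simp add: twisted_spin_def site_op_def scaleC_def spin_matrix_flip sum_distrib_left mult.assoc)
    also have "\<dots> = twisted_spin N a j \<psi> (rot w)"
      using assms(2)
      by (subst sum_flip[of "\<lambda>k. spin_matrix a $ flip b $ k * \<psi> ((rot w)[j := k])"])
        (simp add: twisted_spin_def site_op_def u(1) j)
    finally show ?thesis .
  qed
qed

lemma shifted_bond_term:
  assumes "shifted N \<phi> \<psi>" "j + 1 < N"
  shows "shifted N (bond_term N x (j + 1) \<phi>) (bond_term N x j \<psi>)"
  unfolding bond_term_def Let_def
  using assms by (intro shifted_closed shifted_twisted_spin) auto

text \<open>By the twist the boundary bond is a translate like any other, so every bond is the first
  one seen after k rotations.\<close>

lemma bond_term_rot:
  assumes "\<forall>v\<in>configs N. \<phi> v = \<psi> ((rot ^^ k) v)" "k < N" "w \<in> configs N"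
  shows "bond_term N x k \<phi> w = bond_term N x 0 \<psi> ((rot ^^ k) w)"
  using assms
proof (induction k arbitrary: \<phi> w)
  case 0
  have shifted_eq: "twisted_spin N a j \<phi>' v = twisted_spin N a j \<psi>' v"
    if "\<forall>v\<in>configs N. \<phi>' v = \<psi>' v" "v \<in> configs N" for \<phi>' \<psi>' v a j
    using that by (simp add: twisted_spin_def site_op_def scaleC_def configs_def)
  show ?case
    using 0 by (auto simp: bond_term_def Let_def scaleC_def sum_fun_apply intro!: sum.cong arg_cong2[of _ _ _ _ "(-)"]
        arg_cong2[of _ _ _ _ "(+)"] arg_cong2[of _ _ _ _ "(*)"] shifted_eq)
next
  case (Suc k)
  define \<eta> where "\<eta> v = \<psi> ((rot ^^ k) v)" for v
  have "shifted N \<phi> \<eta>"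
    using Suc.prems(1) by (simp add: shifted_def \<eta>_def funpow_swap1)
  then have "bond_term N x (Suc k) \<phi> w = bond_term N x k \<eta> (rot w)"
    using shifted_bond_term[of N \<phi> \<eta> k x] Suc.prems by (simp add: shifted_def)
  also have "\<dots> = bond_term N x 0 \<psi> ((rot ^^ k) (rot w))"
    using Suc.prems by (intro Suc.IH) (auto simp: \<eta>_def)
  finally show ?case
    by (simp add: funpow_swap1)
qed

lemma spin_matrix_apply:
  "(\<Sum>k\<in>UNIV. spin_matrix 1 $ i $ k * f k) = complex_of_real (1 / sqrt 2) * (if i = 2 then f 1 + f 3 else f 2)"
  "(\<Sum>k\<in>UNIV. spin_matrix 2 $ i $ k * f k) = complex_of_real (1 / sqrt 2) *
     (if i = 1 then - \<i> * f 2 else if i = 2 then \<i> * f 1 - \<i> * f 3 else \<i> * f 2)"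
  "(\<Sum>k\<in>UNIV. spin_matrix 3 $ i $ k * f k) = (if i = 1 then f 1 else if i = 2 then 0 else - f 3)"
  using exhaust_3[of i]
  by (auto simp: sum_3 spin_matrix_def algebra_simps add_divide_distrib diff_divide_distrib)

text \<open>It combines two left-right asymmetries: the Hamiltonian charges its one-site term to the
  left site of a bond, and \<open>bond_weight\<close> inherits the gauge of
  \<open>fused\<close>.\<close>

definition site_weight :: "complex \<Rightarrow> 3 \<Rightarrow> complex"
  where "site_weight x a = (if a = 2 then 0 else x\<^sup>2 - 2)"

lemma bond_term_0:
  assumes "N \<ge> 2"
  shows "bond_term N x 0 \<psi> (a # b # p) =
    (\<Sum>c\<in>UNIV. \<Sum>d\<in>UNIV. bond_weight x a b c d * \<psi> (c # d # p)) +
    (site_weight x a - site_weight x b) * \<psi> (a # b # p)"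
proof -
  define r where "r = complex_of_real (1 / sqrt 2)"
  have r: "r * r = 1 / 2" "r * (r * z) = z / 2" for z
  proof -
    show *: "r * r = 1 / 2"
      unfolding r_def of_real_mult[symmetric] by (simp add: field_simps)
    show "r * (r * z) = z / 2"
      using * by (simp add: mult.assoc[symmetric])
  qed
  have ts: "twisted_spin N e 0 = site_op (spin_matrix e) 0" "twisted_spin N e 1 = site_op (spin_matrix e) 1" for e
    using assms by (auto simp: twisted_spin_def)
  have s0: "site_op (spin_matrix 1) 0 \<phi> (a # b # p) = r * (if a = 2 then \<phi> (1 # b # p) + \<phi> (3 # b # p) else \<phi> (2 # b # p))"
    "site_op (spin_matrix 2) 0 \<phi> (a # b # p) = r *
     (if a = 1 then - \<i> * \<phi> (2 # b # p) else if a = 2 then \<i> * \<phi> (1 # b # p) - \<i> * \<phi> (3 # b # p) else \<i> * \<phi> (2 # b # p))"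
    "site_op (spin_matrix 3) 0 \<phi> (a # b # p) = (if a = 1 then \<phi> (1 # b # p) else if a = 2 then 0 else - \<phi> (3 # b # p))"
    "site_op (spin_matrix 1) 1 \<phi> (a # b # p) = r * (if b = 2 then \<phi> (a # 1 # p) + \<phi> (a # 3 # p) else \<phi> (a # 2 # p))"
    "site_op (spin_matrix 2) 1 \<phi> (a # b # p) = r *
     (if b = 1 then - \<i> * \<phi> (a # 2 # p) else if b = 2 then \<i> * \<phi> (a # 1 # p) - \<i> * \<phi> (a # 3 # p) else \<i> * \<phi> (a # 2 # p))"
    "site_op (spin_matrix 3) 1 \<phi> (a # b # p) = (if b = 1 then \<phi> (a # 1 # p) else if b = 2 then 0 else - \<phi> (a # 3 # p))"
    for \<phi> a b
    by (simp_all add: site_op_def spin_matrix_apply r_def)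
  show ?thesis
    using exhaust_3[of a] exhaust_3[of b]
    unfolding bond_term_def Let_def add_0 ts
    apply (elim disjE)
    apply (simp_all add: sum_3 scaleC_def coupling_J_def coupling_A_def s0 bond_weight_def site_weight_def
       del: One_nat_def)
    apply (simp_all add: r algebra_simps power2_eq_square)
    done
qed

lemma hamiltonian_kernel:
  assumes N: "N \<ge> 2" and \<phi>: "\<phi> \<in> chain_space N"
  shows "hamiltonian N x \<phi> = kact N (chain_kernel N (bond_weight (complex_of_real x))) \<phi>"
proof
  fix w :: "3 list"
  show "hamiltonian N x \<phi> w = kact N (chain_kernel N (bond_weight (complex_of_real x))) \<phi> w"
  proof (cases "w \<in> configs N")
    case True
    let ?g = "bond_weight (complex_of_real x)" and ?D = "\<lambda>w v. site_weight (complex_of_real x) (hd w) * of_bool (w = v)"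
    have "bond_term N x k \<phi> w = (\<Sum>v\<in>configs N. (bond ?g ((rot ^^ k) w) ((rot ^^ k) v) +
        (?D ((rot ^^ k) w) ((rot ^^ k) v) - ?D (rot ((rot ^^ k) w)) (rot ((rot ^^ k) v)))) * \<phi> v)"
      if k: "k < N" for k
    proof -
      have "inj (rot ^^ k)"
        by (auto intro: injI)
      \<comment> \<open>The state in the frame where bond k becomes the first bond;
        \<open>rot ^^ k\<close> is injective on all lists, so \<open>inv\<close> undoes it.\<close>
      define \<psi> where "\<psi> v = \<phi> (inv (rot ^^ k) v)" for v
      have \<psi>: "\<psi> ((rot ^^ k) v) = \<phi> v" for v
        using \<open>inj (rot ^^ k)\<close> by (simp add: \<psi>_def inv_f_f)
      define w' where "w' = (rot ^^ k) w"
      have "w' \<in> configs N"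
        using True by (simp add: w'_def)
      then obtain a b p where w': "w' = a # b # p" "p \<in> configs (N - 2)"
        using configs_ge_2E[OF _ N] by blast
      have N2: "N = Suc (Suc (N - 2))" using N by simp
      have "bond_term N x k \<phi> w = bond_term N x 0 \<psi> w'"
        unfolding w'_def using True k by (intro bond_term_rot) (simp_all add: \<psi>)
      also have "\<dots> = (\<Sum>u\<in>configs N. (bond ?g w' u + (?D w' u - ?D (rot w') (rot u))) * \<psi> u)"
      proof -
        have "(\<Sum>u\<in>configs N. bond ?g w' u * \<psi> u) = (\<Sum>c\<in>UNIV. \<Sum>d\<in>UNIV. ?g a b c d * \<psi> (c # d # p))"
          using w'(2) by (subst N2) (simp add: sum_configs_Suc w'(1) bond_def of_bool_def
            if_distrib[of "\<lambda>y. y * _"] if_distrib[of "\<lambda>y. _ * y"] cong: if_cong)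
        moreover have "(\<Sum>u\<in>configs N. (?D w' u - ?D (rot w') (rot u)) * \<psi> u) =
            (site_weight (complex_of_real x) a - site_weight (complex_of_real x) b) * \<psi> w'"
        proof -
          have hd: "hd w' = a" "hd (rot w') = b"
            by (simp_all add: w'(1))
          have "(\<Sum>u\<in>configs N. (?D w' u - ?D (rot w') (rot u)) * \<psi> u) =
              (\<Sum>u\<in>configs N. if u = w' then (site_weight (complex_of_real x) a - site_weight (complex_of_real x) b) * \<psi> w' else 0)"
            by (intro sum.cong refl) (auto simp: hd)
          then show ?thesis
            using \<open>w' \<in> configs N\<close> by simp
        qed
        ultimately show ?thesis
          by (simp only: distrib_right sum.distrib bond_term_0[OF N] w'(1))
      qed
      also have "\<dots> = (\<Sum>v\<in>configs N. (bond ?g w' ((rot ^^ k) v) + (?D w' ((rot ^^ k) v) - ?D (rot w') (rot ((rot ^^ k) v)))) * \<psi> ((rot ^^ k) v))"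
        by (rule sum_rot_funpow[symmetric])
      finally show ?thesis
        by (simp only: \<psi> w'_def)
    qed
    then have "hamiltonian N x \<phi> w = (\<Sum>v\<in>configs N. (\<Sum>k<N. bond ?g ((rot ^^ k) w) ((rot ^^ k) v) +
        (?D ((rot ^^ k) w) ((rot ^^ k) v) - ?D (rot ((rot ^^ k) w)) (rot ((rot ^^ k) v)))) * \<phi> v)"
      unfolding hamiltonian_bond_terms sum_fun_apply sum_distrib_right
      by (subst sum.swap) (intro sum.cong refl, simp)
    also have "\<dots> = (\<Sum>v\<in>configs N. chain_kernel N ?g w v * \<phi> v)"
    proof (intro sum.cong refl arg_cong2[of _ _ _ _ "(*)"])
      fix v :: "3 list"
      assume v: "v \<in> configs N"
      obtain a p where w: "w = a # p"
        using True N by (cases w) (auto simp: configs_def)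
      \<comment> \<open>\<open>site_weight\<close> only distinguishes the letter 2, which
        \<open>flip\<close> fixes, so these diagonal terms telescope to 0 around the twisted
        chain.\<close>
      have "?D (map flip w) (map flip v) = ?D w v"
        using inj_map_eq_map[of flip w v] by (simp add: w inj_def site_weight_def)
      from rot_telescope[of w N v ?D, OF True v this]
      show "(\<Sum>k<N. bond ?g ((rot ^^ k) w) ((rot ^^ k) v) +
          (?D ((rot ^^ k) w) ((rot ^^ k) v) - ?D (rot ((rot ^^ k) w)) (rot ((rot ^^ k) v)))) = chain_kernel N ?g w v"
        by (simp only: sum.distrib chain_kernel_def add_0_right)
    qed
    finally show ?thesis
      using True by (simp add: kact_def)
  next
    case False
    then show ?thesis
      using hamiltonian_in_chain_space[OF \<phi>, of x] by (simp add: chain_space_iff kact_def)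
  qed
qed

section \<open>Hermiticity and parity of the chain kernel\<close>

lemma bond_weight_symmetric: "bond_weight x c d a b = bond_weight x a b c d"
  using exhaust_3[of a] exhaust_3[of b] exhaust_3[of c] exhaust_3[of d]
  by (elim disjE) (simp_all add: bond_weight_def)

lemma cnj_bond_weight: "cnj (bond_weight (complex_of_real x) a b c d) = bond_weight (complex_of_real x) a b c d"
  using exhaust_3[of a] exhaust_3[of b] exhaust_3[of c] exhaust_3[of d]
  by (elim disjE) (simp_all add: bond_weight_def)

lemma bond_symmetric: "bond (bond_weight x) v w = bond (bond_weight x) w v"
  by (cases w; cases "tl w"; cases v; cases "tl v")
    (auto simp: bond_def intro: bond_weight_symmetric)

lemma cnj_bond: "cnj (bond (bond_weight (complex_of_real x)) w v) = bond (bond_weight (complex_of_real x)) w v"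
  by (cases w; cases "tl w"; cases v; cases "tl v") (auto simp: bond_def cnj_bond_weight)

lemma chain_kernel_hermitian:
  "chain_kernel N (bond_weight (complex_of_real x)) v w = cnj (chain_kernel N (bond_weight (complex_of_real x)) w v)"
  by (simp add: chain_kernel_def cnj_bond) (intro sum.cong refl bond_symmetric)

lemma bond_weight_even:
  "sgn_mag [a, b] * bond_weight x a b c d = bond_weight x a b c d * sgn_mag [c, d]"
  using exhaust_3[of a] exhaust_3[of b] exhaust_3[of c] exhaust_3[of d]
  by (elim disjE) (simp_all add: bond_weight_def)

lemma bond_even: "sgn_mag w * bond (bond_weight x) w v = bond (bond_weight x) w v * sgn_mag v"
proof (cases "\<exists>a b p c d. w = a # b # p \<and> v = c # d # p")
  case True
  then obtain a b c d p where wv: "w = a # b # p" "v = c # d # p" by blast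
  have "sgn_mag w * bond (bond_weight x) w v = sgn_mag [a, b] * bond_weight x a b c d * sgn_mag p"
    by (simp add: wv bond_def)
  also have "\<dots> = bond (bond_weight x) w v * sgn_mag v"
    unfolding bond_weight_even by (simp add: wv bond_def)
  finally show ?thesis .
next
  case False
  then have "bond (bond_weight x) w v = 0"
    by (auto simp: bond_def split: list.split)
  then show ?thesis by simp
qed

lemma sgn_mag_rot_funpow [simp]: "sgn_mag ((rot ^^ k) w) = sgn_mag w"
  by (induction k) auto

lemma chain_kernel_even:
  "sgn_mag w * chain_kernel N (bond_weight x) w v = chain_kernel N (bond_weight x) w v * sgn_mag v"
  unfolding chain_kernel_def sum_distrib_left sum_distrib_right
  using bond_even[of "(rot ^^ k) w" x "(rot ^^ k) v" for k] by (simp only: sgn_mag_rot_funpow)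

theorem proposition2p3:
  fixes N :: nat and x :: real and E :: complex
  assumes "N \<ge> 2" and "E \<noteq> 0"
  shows "chain.dim (eigenspace_on (parity_sector N 1) (hamiltonian N x) E) =
         chain.dim (eigenspace_on (parity_sector N (-1)) (hamiltonian N x) E)"
proof -
  have "eigenspace_on (parity_sector N \<sigma>) (hamiltonian N x) E =
      eigenspace_on (parity_sector N \<sigma>) (kact N (chain_kernel N (bond_weight (complex_of_real x)))) E" for \<sigma>
    using hamiltonian_kernel[OF assms(1)] by (auto simp: eigenspace_on_def parity_sector_def)
  then show ?thesis
    using eigenspace_dim_eq[where h = "chain_kernel N (bond_weight (complex_of_real x))",
        OF chain_kernel_hermitian chain_kernel_even strace_chain_kernel_power[OF assms(1)] assms(2)]
    by (simp only:)
qed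

end
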